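(* Let $p>0$, let $\mathbb{T}$ be a $p$-periodic time scale and let $A:\mathbb{T}\to\mathbb{R}^{n\times n}$ be regressive and $p$-periodic. Given any $t_0\in\mathbb{T}$, there exists an initial state $x(t_0)=x_0\neq0$ such that the solution of $$x^\Delta(t)=A(t)x(t),\quad x(t_0)=x_0$$ is $p$-periodic if and only if at least one of the eigenvalues of $\Phi_A(t_0+p,t_0)$ is $1$.
   Context: A time scale $\mathbb{T}$ is a nonempty closed subset of $\mathbb{R}$; $\sigma(t)=\inf\{s\in\mathbb{T}:s>t\}$, $\mu(t)=\sigma(t)-t$, $f^\Delta$ is the delta (Hilger) derivative. $\mathbb{T}$ is $p$-periodic if for all $t\in\mathbb{T}$: $t+p\in\mathbb{T}$ and $\mu(t)=\mu(t+p)$; it is assumed that $0\le\mu(t)\le p$. A function $F$ on $\mathbb{T}$ is $p$-periodic if $F(t+p)=F(t)$ for all $t\in\mathbb{T}$. $A$ is regressive if it is rd-continuous and $I+\mu(t)A(t)$ is invertible for all $t$. $\Phi_A(t,\tau)$ is the transition matrix: the unique solution of $X^\Delta=A(t)X$, $X(\tau)=I$. *)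

theory Defs
  imports "HOL-Analysis.Analysis"
begin

definition time_scale :: "real set \<Rightarrow> bool" where
  "time_scale T \<longleftrightarrow> closed T \<and> T \<noteq> {}"

text \<open>The jump operators follow the usual conventions \<open>inf {} = sup T\<close> and \<open>sup {} = inf T\<close>:
  a maximum, respectively minimum, of \<open>T\<close> is mapped to itself.\<close>

definition sigma :: "real set \<Rightarrow> real \<Rightarrow> real" where
  "sigma T t = (if \<exists>s\<in>T. t < s then Inf {s \<in> T. t < s} else t)"

definition rho :: "real set \<Rightarrow> real \<Rightarrow> real" where
  "rho T t = (if \<exists>s\<in>T. s < t then Sup {s \<in> T. s < t} else t)"

definition mu :: "real set \<Rightarrow> real \<Rightarrow> real" where
  "mu T t = sigma T t - t"

definition right_dense :: "real set \<Rightarrow> real \<Rightarrow> bool" where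
  "right_dense T t \<longleftrightarrow> t \<in> T \<and> (\<exists>s\<in>T. t < s) \<and> sigma T t = t"

definition left_dense :: "real set \<Rightarrow> real \<Rightarrow> bool" where
  "left_dense T t \<longleftrightarrow> t \<in> T \<and> (\<exists>s\<in>T. s < t) \<and> rho T t = t"

definition rd_continuous :: "real set \<Rightarrow> (real \<Rightarrow> 'a::topological_space) \<Rightarrow> bool" where
  "rd_continuous T f \<longleftrightarrow>
     (\<forall>t. right_dense T t \<longrightarrow> continuous (at t within T) f) \<and>
     (\<forall>t. left_dense T t \<longrightarrow> (\<exists>l. (f \<longlongrightarrow> l) (at t within (T \<inter> {..<t}))))"

definition has_delta_derivative ::
    "real set \<Rightarrow> (real \<Rightarrow> 'a::real_normed_vector) \<Rightarrow> 'a \<Rightarrow> real \<Rightarrow> bool" where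
  "has_delta_derivative T f D t \<longleftrightarrow>
     (\<forall>\<epsilon>>0. \<exists>\<delta>>0. \<forall>s\<in>T. \<bar>t - s\<bar> < \<delta> \<longrightarrow>
        norm (f (sigma T t) - f s - (sigma T t - s) *\<^sub>R D) \<le> \<epsilon> * \<bar>sigma T t - s\<bar>)"

text \<open>The last conjunct is a standing assumption; for \<open>p > 0\<close> it already follows from the others.\<close>

definition periodic_time_scale :: "real \<Rightarrow> real set \<Rightarrow> bool" where
  "periodic_time_scale p T \<longleftrightarrow> time_scale T \<and>
     (\<forall>t\<in>T. t + p \<in> T \<and> mu T t = mu T (t + p)) \<and>
     (\<forall>t\<in>T. 0 \<le> mu T t \<and> mu T t \<le> p)"

definition periodic_on :: "real set \<Rightarrow> real \<Rightarrow> (real \<Rightarrow> 'a) \<Rightarrow> bool" where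
  "periodic_on T p F \<longleftrightarrow> (\<forall>t\<in>T. F (t + p) = F t)"

definition regressive :: "real set \<Rightarrow> (real \<Rightarrow> real ^ 'n ^ 'n) \<Rightarrow> bool" where
  "regressive T A \<longleftrightarrow> rd_continuous T A \<and> (\<forall>t\<in>T. invertible (mat 1 + mu T t *\<^sub>R A t))"

text \<open>Requiring the equations below at every point of \<open>T\<close> is the same as requiring them at every
  point of \<open>T\<close> other than a left-scattered maximum, since there any value is a delta derivative.
  A periodic time scale with positive period has no maximum in any case.\<close>

definition solves_ivp ::
    "real set \<Rightarrow> (real \<Rightarrow> real ^ 'n ^ 'n) \<Rightarrow> real \<Rightarrow> real ^ 'n \<Rightarrow> (real \<Rightarrow> real ^ 'n) \<Rightarrow> bool" where
  "solves_ivp T A t\<^sub>0 x\<^sub>0 x \<longleftrightarrow>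
     (\<forall>t\<in>T. has_delta_derivative T x (A t *v x t) t) \<and> x t\<^sub>0 = x\<^sub>0"

definition solves_matrix_ivp ::
    "real set \<Rightarrow> (real \<Rightarrow> real ^ 'n ^ 'n) \<Rightarrow> real \<Rightarrow> (real \<Rightarrow> real ^ 'n ^ 'n) \<Rightarrow> bool" where
  "solves_matrix_ivp T A \<tau> X \<longleftrightarrow>
     (\<forall>t\<in>T. has_delta_derivative T X (A t ** X t) t) \<and> X \<tau> = mat 1"

text \<open>Solutions are only determined on \<open>T\<close>; \<^const>\<open>extensional\<close> fixes their values
  elsewhere, so that there is a single solution as a function on all reals.\<close>

definition transition_matrix ::
    "real set \<Rightarrow> (real \<Rightarrow> real ^ 'n ^ 'n) \<Rightarrow> real \<Rightarrow> real \<Rightarrow> real ^ 'n ^ 'n" where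
  "transition_matrix T A t \<tau> =
     (THE X. X \<in> extensional T \<and> solves_matrix_ivp T A \<tau> X) t"

definition eigenvalue :: "'a::field ^ 'n ^ 'n \<Rightarrow> 'a \<Rightarrow> bool" where
  "eigenvalue M k \<longleftrightarrow> (\<exists>v. v \<noteq> 0 \<and> M *v v = k *s v)"

end

theory Submission
  imports Defs
begin

text \<open>A solution of \<open>x\<^sup>\<Delta> = A x\<close> and its translate by \<open>p\<close> solve the same equation, so by uniqueness the
  solution is periodic as soon as \<open>x (t\<^sub>0 + p) = x t\<^sub>0\<close>, that is, as soon as \<open>x t\<^sub>0\<close> is a fixed vector of
  \<open>\<Phi>\<^sub>A(t\<^sub>0 + p, t\<^sub>0)\<close>. The substance is existence and uniqueness on all of \<open>T\<close>. Writing \<open>r u\<close> for the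
  largest point of \<open>T\<close> up to \<open>u\<close>, the delta equation is equivalent to the ordinary integral equation
  \<open>x t - x s = \<integral>\<^sub>s\<^sup>t A (r u) x (r u) du\<close>. Forward in time it is solved by Banach's fixed point theorem in an
  exponentially weighted norm. Uniqueness holds in both directions, regressivity being what allows to
  go back across a gap; hence the linear map from the state at an early time to the state at \<open>t\<^sub>0\<close> is
  injective, so bijective, and solutions through \<open>t\<^sub>0\<close> exist to the left as well.\<close>

section \<open>Integrals over a time scale\<close>

locale unbounded_time_scale =
  fixes T :: "real set"
  assumes closed: "closed T"
    and unbounded: "t \<in> T \<Longrightarrow> \<exists>s\<in>T. t < s"
begin

text \<open>The value is meaningful only if \<open>T\<close> has a point at or below \<open>s\<close>.\<close>

definition ts_floor :: "real \<Rightarrow> real" where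
  "ts_floor s = Sup (T \<inter> {..s})"

lemma ts_floor_in: "\<lbrakk>a \<in> T; a \<le> s\<rbrakk> \<Longrightarrow> ts_floor s \<in> T"
  and ts_floor_le: "\<lbrakk>a \<in> T; a \<le> s\<rbrakk> \<Longrightarrow> ts_floor s \<le> s"
proof -
  assume "a \<in> T" "a \<le> s"
  then have "ts_floor s \<in> T \<inter> {..s}"
    unfolding ts_floor_def by (intro closed_contains_Sup closed_Int closed) auto
  then show "ts_floor s \<in> T" "ts_floor s \<le> s" by auto
qed

lemma le_ts_floor: "\<lbrakk>t \<in> T; t \<le> s\<rbrakk> \<Longrightarrow> t \<le> ts_floor s"
  unfolding ts_floor_def by (intro cSup_upper) auto

lemma ts_floor_eqI:
  assumes "t \<in> T" "t \<le> s" "\<And>u. \<lbrakk>u \<in> T; u \<le> s\<rbrakk> \<Longrightarrow> u \<le> t"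
  shows "ts_floor s = t"
  using assms ts_floor_in[of t s] ts_floor_le[of t s] le_ts_floor[of t s] by (intro antisym) auto

lemma ts_floor_self [simp]: "t \<in> T \<Longrightarrow> ts_floor t = t"
  by (rule ts_floor_eqI) auto

lemma sigma_in: "t \<in> T \<Longrightarrow> sigma T t \<in> T"
  and sigma_ge: "t \<in> T \<Longrightarrow> t \<le> sigma T t"
proof -
  assume t: "t \<in> T"
  let ?S = "{s \<in> T. t < s}"
  have ne: "?S \<noteq> {}" using unbounded[OF t] by auto
  have "bdd_below ?S" by (rule bdd_belowI[of _ t]) auto
  then have "Inf ?S \<in> closure ?S" by (rule closure_contains_Inf[OF ne])
  also have "closure ?S \<subseteq> T" by (rule closure_minimal) (auto simp: closed)
  finally show "sigma T t \<in> T" using ne by (auto simp: sigma_def t)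
  have "t \<le> Inf ?S" by (rule cInf_greatest[OF ne]) auto
  then show "t \<le> sigma T t" by (auto simp: sigma_def)
qed

lemma sigma_le: "\<lbrakk>s \<in> T; t < s\<rbrakk> \<Longrightarrow> sigma T t \<le> s"
  unfolding sigma_def by (auto intro!: cInf_lower bdd_belowI[of _ t])

lemma right_dense_iff: "right_dense T t \<longleftrightarrow> t \<in> T \<and> sigma T t = t"
  using unbounded by (auto simp: right_dense_def)

lemma sigma_eqI:
  assumes "c \<in> T" "d \<in> T" "c < d" "\<And>u. \<lbrakk>u \<in> T; c < u\<rbrakk> \<Longrightarrow> d \<le> u"
  shows "sigma T c = d"
  using assms sigma_le[of d c] unfolding sigma_def
  by (auto intro!: antisym cInf_greatest cInf_lower bdd_belowI[of _ c])

text \<open>If \<open>s\<close> lies below \<open>sigma T (ts_floor s)\<close>, the floor is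
  constant just to the right of \<open>s\<close>. Otherwise \<open>s\<close> is itself a right-dense
  point, where \<open>h\<close> is continuous, and \<open>ts_floor u\<close> is squeezed between
  \<open>s\<close> and \<open>u\<close>.\<close>

lemma right_continuous_ts_floor:
  fixes h :: "real \<Rightarrow> 'a::topological_space"
  assumes h: "\<And>t. right_dense T t \<Longrightarrow> continuous (at t within T) h"
    and a: "a \<in> T" "a \<le> s"
  shows "((\<lambda>u. h (ts_floor u)) \<longlongrightarrow> h (ts_floor s)) (at_right s)"
proof -
  let ?t = "ts_floor s"
  have t: "?t \<in> T" "?t \<le> s" using a ts_floor_in ts_floor_le by auto
  show ?thesis
  proof (cases "s < sigma T ?t")
    case True
    have "eventually (\<lambda>u. u \<in> {s<..<sigma T ?t}) (at_right s)"
      using eventually_at_right_real[OF True] .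
    then have "eventually (\<lambda>u. h (ts_floor u) = h ?t) (at_right s)"
    proof (rule eventually_mono)
      fix u assume "u \<in> {s<..<sigma T ?t}"
      then have "ts_floor u = ?t"
        using t sigma_le[of _ ?t] by (intro ts_floor_eqI) force+
      then show "h (ts_floor u) = h ?t" by simp
    qed
    then show ?thesis by (rule tendsto_eventually)
  next
    case False
    have sig: "sigma T ?t \<in> T" "?t \<le> sigma T ?t" "sigma T ?t \<le> s"
      using False t sigma_in sigma_ge by auto
    then have sig_eq: "sigma T ?t = ?t"
      using le_ts_floor[of "sigma T ?t" s] by auto
    \<comment> \<open>No point of \<open>T\<close> lies above \<open>?t\<close> and at or below
      \<open>s\<close>, so the infimum defining the jump is at least \<open>s\<close>; with the
      previous equality this forces \<open>?t = s\<close>.\<close>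
    have "s \<le> sigma T ?t"
    proof -
      have ne: "{u \<in> T. ?t < u} \<noteq> {}" using unbounded[OF t(1)] by auto
      have "s \<le> Inf {u \<in> T. ?t < u}"
        using le_ts_floor[of _ s] by (intro cInf_greatest[OF ne]) (force simp: not_le[symmetric])
      then show ?thesis using ne by (auto simp: sigma_def)
    qed
    then have "?t = s" using sig_eq t by auto
    moreover from this have "sigma T s = s" using sig_eq by simp
    ultimately have rd: "right_dense T s" using t by (auto simp: right_dense_iff)
    then have s: "s \<in> T" by (simp add: right_dense_iff)
    have "((\<lambda>u. ts_floor u) \<longlongrightarrow> s) (at_right s)"
    proof (rule tendsto_sandwich[OF _ _ tendsto_const tendsto_ident_at])
      show "\<forall>\<^sub>F u in at_right s. s \<le> ts_floor u" "\<forall>\<^sub>F u in at_right s. ts_floor u \<le> u"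
        using le_ts_floor[OF s] ts_floor_le[OF s] by (auto simp: eventually_at_filter)
    qed
    moreover have "\<forall>\<^sub>F u in at_right s. ts_floor u \<in> T"
      using ts_floor_in[OF s] by (auto simp: eventually_at_filter)
    ultimately show ?thesis
      using continuous_within_tendsto_compose[OF h[OF rd]] \<open>?t = s\<close> by simp
  qed
qed

end

text \<open>The function is the pointwise limit of its samples at the grid points \<open>(\<lfloor>n s\<rfloor> + 1) / n\<close>, which approach
  \<open>s\<close> from the right.\<close>

lemma borel_measurable_right_continuous:
  fixes k :: "real \<Rightarrow> 'a::metric_space"
  assumes "\<And>s. (k \<longlongrightarrow> k s) (at_right s)"
  shows "k \<in> borel_measurable borel"
proof (rule borel_measurable_LIMSEQ_metric)
  define u where "u n s = (of_int \<lfloor>real (Suc n) * s\<rfloor> + 1) / real (Suc n)" for n and s :: real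
  show "(\<lambda>s. k (u n s)) \<in> borel_measurable borel" for n
  proof -
    have "(\<lambda>s. \<lfloor>real (Suc n) * s\<rfloor>) \<in> borel \<rightarrow>\<^sub>M count_space UNIV" by measurable
    then have "(\<lambda>s. (\<lambda>i. k ((of_int i + 1) / real (Suc n))) \<lfloor>real (Suc n) * s\<rfloor>) \<in> borel_measurable borel"
      by (rule measurable_compose) simp
    then show ?thesis by (simp add: u_def)
  qed
  show "(\<lambda>n. k (u n s)) \<longlonglongrightarrow> k s" for s
  proof -
    have gt: "s < u n s" and le: "u n s \<le> s + 1 / real (Suc n)" for n
    proof -
      have "real (Suc n) * s < of_int \<lfloor>real (Suc n) * s\<rfloor> + 1" by linarith
      then show "s < u n s" unfolding u_def by (simp add: pos_less_divide_eq mult.commute)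
      have "of_int \<lfloor>real (Suc n) * s\<rfloor> \<le> real (Suc n) * s" by linarith
      then show "u n s \<le> s + 1 / real (Suc n)"
        unfolding u_def by (simp add: field_simps del: of_nat_Suc)
    qed
    have "(\<lambda>n. u n s) \<longlonglongrightarrow> s"
    proof (rule tendsto_sandwich[OF _ _ tendsto_const])
      show "\<forall>\<^sub>F n in sequentially. s \<le> u n s" "\<forall>\<^sub>F n in sequentially. u n s \<le> s + 1 / real (Suc n)"
        using less_imp_le[OF gt] le by (simp_all only: eventually_True)
      show "(\<lambda>n. s + 1 / real (Suc n)) \<longlonglongrightarrow> s"
        using tendsto_add[OF tendsto_const[of s] LIMSEQ_inverse_real_of_nat] by (simp add: inverse_eq_divide)
    qed
    then have "filterlim (\<lambda>n. u n s) (at_right s) sequentially"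
      using gt by (simp add: filterlim_at less_imp_neq[THEN not_sym])
    then show ?thesis by (rule filterlim_compose[OF assms])
  qed
qed

section \<open>Integrability along the floor, and boundedness of rd-continuous functions\<close>

context unbounded_time_scale begin

text \<open>Right continuity gives Borel measurability, and a bounded measurable function on a
  compact interval is integrable.\<close>

lemma integrable_ts_floor:
  fixes h :: "real \<Rightarrow> 'e::euclidean_space"
  assumes h: "\<And>t. right_dense T t \<Longrightarrow> continuous (at t within T) h"
    and a: "a \<in> T"
    and bound: "\<And>t. \<lbrakk>t \<in> T; a \<le> t; t \<le> b\<rbrakk> \<Longrightarrow> norm (h t) \<le> C"
  shows "(\<lambda>u. h (ts_floor u)) integrable_on {a..b}"
proof -
  \<comment> \<open>Freezing the argument at \<open>a\<close> avoids the region where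
    \<open>ts_floor\<close> may be meaningless and makes \<open>?k\<close> right-continuous on the
    whole line.\<close>
  let ?k = "\<lambda>s. h (ts_floor (max a s))"
  have "(?k \<longlongrightarrow> ?k s) (at_right s)" for s
  proof (cases "a \<le> s")
    case True
    have "\<forall>\<^sub>F u in at_right s. h (ts_floor u) = ?k u"
      using True by (auto simp: eventually_at_filter max_def)
    then show ?thesis
      using right_continuous_ts_floor[OF h a True] True tendsto_cong[of "\<lambda>u. h (ts_floor u)" ?k]
      by (auto simp: max_def)
  next
    case False
    then have "\<forall>\<^sub>F u in at_right s. ?k u = ?k s"
      using eventually_at_right_real[of s a] by (auto elim!: eventually_mono)
    then show ?thesis by (rule tendsto_eventually)
  qed
  then have "?k \<in> borel_measurable borel"
    by (rule borel_measurable_right_continuous)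
  then have "?k \<in> borel_measurable (lebesgue_on {a..b})"
    by (simp add: measurable_completion measurable_restrict_space1)
  moreover have "norm (?k s) \<le> C" if "s \<in> {a..b}" for s
    using that a bound ts_floor_in[of a s] ts_floor_le[of a s] le_ts_floor[of a s] by (auto simp: max_def)
  ultimately have "?k integrable_on {a..b}"
    by (rule measurable_bounded_by_integrable_imp_integrable[OF _ integrable_const_ivl]) simp_all
  then show ?thesis by (rule integrable_eq) auto
qed

text \<open>Local boundedness at every point, then a finite subcover of the compact set
  \<open>T \<inter> {a..b}\<close>. On each side of a point of \<open>T\<close>, either
  \<open>h\<close> has a one-sided limit or no point of \<open>T\<close> is nearby.\<close>

lemma rd_continuous_bounded:
  fixes h :: "real \<Rightarrow> 'a::real_normed_vector"
  assumes rd: "rd_continuous T h"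
  shows "bounded (h ` (T \<inter> {a..b}))"
proof -
  have left: "\<exists>C. \<forall>\<^sub>F s in at t within (T \<inter> {..<t}). norm (h s) \<le> C" if t: "t \<in> T" for t
  proof (cases "left_dense T t")
    case True
    then obtain l where "(h \<longlongrightarrow> l) (at t within (T \<inter> {..<t}))"
      using rd unfolding rd_continuous_def by blast
    from tendsto_norm[OF this] have "\<forall>\<^sub>F s in at t within (T \<inter> {..<t}). norm (h s) < norm l + 1"
      by (rule order_tendstoD) simp
    then show ?thesis by (auto elim!: eventually_mono intro!: exI[of _ "norm l + 1"])
  next
    case False
    have "\<forall>\<^sub>F s in at t within (T \<inter> {..<t}). False"
    proof (cases "\<exists>s\<in>T. s < t")
      case True
      have bdd: "bdd_above {s \<in> T. s < t}" by (rule bdd_aboveI[of _ t]) auto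
      have "rho T t \<le> t" using True unfolding rho_def by (auto intro!: cSup_least)
      with False True t have "rho T t < t" by (auto simp: left_dense_def)
      then have "\<forall>\<^sub>F s in at t. rho T t < s" by (rule order_tendstoD(1)[OF tendsto_ident_at])
      then show ?thesis
        unfolding eventually_at_filter
      proof (rule eventually_mono, intro impI)
        fix s assume "s \<noteq> t \<longrightarrow> s \<in> UNIV \<longrightarrow> rho T t < s" "s \<noteq> t" "s \<in> T \<inter> {..<t}"
        moreover from this have "s \<le> rho T t"
          using True cSup_upper[OF _ bdd, of s] by (simp add: rho_def)
        ultimately show False by auto
      qed
    next
      case False
      then show ?thesis by (auto simp: eventually_at_filter)
    qed
    then show ?thesis by (auto elim!: eventually_mono)
  qed
  have right: "\<exists>C. \<forall>\<^sub>F s in at t within (T \<inter> {t<..}). norm (h s) \<le> C" if t: "t \<in> T" for t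
  proof (cases "right_dense T t")
    case True
    then have "(h \<longlongrightarrow> h t) (at t within (T \<inter> {t<..}))"
      using rd unfolding rd_continuous_def continuous_within by (blast intro: tendsto_within_subset)
    from tendsto_norm[OF this] have "\<forall>\<^sub>F s in at t within (T \<inter> {t<..}). norm (h s) < norm (h t) + 1"
      by (rule order_tendstoD) simp
    then show ?thesis by (auto elim!: eventually_mono intro!: exI[of _ "norm (h t) + 1"])
  next
    case False
    then have "t < sigma T t" using t sigma_ge[OF t] by (auto simp: right_dense_iff)
    then have "\<forall>\<^sub>F s in at t. s < sigma T t" by (rule order_tendstoD(2)[OF tendsto_ident_at])
    then have "\<forall>\<^sub>F s in at t within (T \<inter> {t<..}). False"
      unfolding eventually_at_filter by (rule eventually_mono) (use sigma_le in force)
    then show ?thesis by (auto elim!: eventually_mono)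
  qed
  have "\<exists>U C. open U \<and> t \<in> U \<and> (\<forall>s\<in>U \<inter> T. norm (h s) \<le> C)" if t: "t \<in> T" for t
  proof -
    obtain C1 C2 where
      1: "\<forall>\<^sub>F s in nhds t. s \<noteq> t \<longrightarrow> s \<in> T \<inter> {..<t} \<longrightarrow> norm (h s) \<le> C1" and
      2: "\<forall>\<^sub>F s in nhds t. s \<noteq> t \<longrightarrow> s \<in> T \<inter> {t<..} \<longrightarrow> norm (h s) \<le> C2"
      using left[OF t] right[OF t] unfolding eventually_at_filter by blast
    have "\<forall>\<^sub>F s in nhds t. s \<in> T \<longrightarrow> norm (h s) \<le> max (norm (h t)) (max C1 C2)"
      using 1 2
    proof eventually_elim
      case (elim s)
      then show ?case by (cases s t rule: linorder_cases) auto
    qed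
    then show ?thesis unfolding eventually_nhds by blast
  qed
  then obtain U C where U: "\<And>t. t \<in> T \<Longrightarrow> open (U t)" "\<And>t. t \<in> T \<Longrightarrow> t \<in> U t"
    and C: "\<And>t s. t \<in> T \<Longrightarrow> s \<in> U t \<inter> T \<Longrightarrow> norm (h s) \<le> C t"
    by metis
  have "compact (T \<inter> {a..b})" using closed by (simp add: closed_Int_compact)
  then obtain F where F: "F \<subseteq> T \<inter> {a..b}" "finite F" "T \<inter> {a..b} \<subseteq> (\<Union>t\<in>F. U t)"
    by (rule compactE_image[of _ "T \<inter> {a..b}" U]) (use U in auto)
  have "norm (h s) \<le> Max (C ` F)" if s: "s \<in> T \<inter> {a..b}" for s
  proof -
    obtain t where t: "t \<in> F" "s \<in> U t" using F s by blast
    then have "norm (h s) \<le> C t" using C[of t s] F s by blast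
    also have "\<dots> \<le> Max (C ` F)" using t F by simp
    finally show ?thesis .
  qed
  then show ?thesis unfolding bounded_iff by blast
qed

section \<open>Integrals across gaps and near right-dense points\<close>

lemma ts_floor_between:
  "\<lbrakk>s \<in> T; t \<in> T; v \<in> {s..t}\<rbrakk> \<Longrightarrow> ts_floor v \<in> T \<inter> {s..t}"
  using ts_floor_in[of s v] le_ts_floor[of s v] ts_floor_le[of s v] by auto

text \<open>The floor is constantly \<open>c\<close> on \<open>{c..<d}\<close> and can differ only
  at the endpoint \<open>d\<close>, which does not affect the integral. This is how graininess
  enters the integral form.\<close>

lemma has_integral_ts_floor_gap:
  fixes g :: "real \<Rightarrow> 'e::euclidean_space"
  assumes "c \<in> T" "c \<le> d" and gap: "\<And>u. \<lbrakk>u \<in> T; c < u\<rbrakk> \<Longrightarrow> d \<le> u"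
  shows "((\<lambda>u. g (ts_floor u)) has_integral (d - c) *\<^sub>R g c) {c..d}"
proof (rule has_integral_spike_finite[where S = "{d}"])
  show "((\<lambda>_. g c) has_integral (d - c) *\<^sub>R g c) {c..d}"
    using has_integral_const_real[of "g c" c d] \<open>c \<le> d\<close> by simp
  fix u assume "u \<in> {c..d} - {d}"
  then have "ts_floor u = c" using assms by (intro ts_floor_eqI) force+
  then show "g (ts_floor u) = g c" by simp
qed simp

text \<open>Floors of points of \<open>{s..u}\<close> stay in \<open>{s..u}\<close>, hence near
  \<open>t\<close>, so the integrand is within \<epsilon> of \<open>g t\<close>. Both endpoints are
  free, so that increments to the left and to the right of \<open>t\<close> are covered.\<close>

lemma integral_ts_floor_near_right_dense:
  fixes g :: "real \<Rightarrow> 'e::euclidean_space"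
  assumes "continuous (at t within T) g" "\<epsilon> > 0"
  obtains \<delta> where "\<delta> > 0"
    "\<And>s u i. \<lbrakk>s \<in> T; u \<in> T; s \<le> u; \<bar>s - t\<bar> < \<delta>; \<bar>u - t\<bar> < \<delta>;
       ((\<lambda>v. g (ts_floor v)) has_integral i) {s..u}\<rbrakk> \<Longrightarrow> norm (i - (u - s) *\<^sub>R g t) \<le> \<epsilon> * (u - s)"
proof -
  obtain \<delta> where \<delta>: "\<delta> > 0" "\<And>v. v \<in> T \<Longrightarrow> dist v t < \<delta> \<Longrightarrow> dist (g v) (g t) < \<epsilon>"
    using assms unfolding continuous_within_eps_delta by metis
  have "norm (i - (u - s) *\<^sub>R g t) \<le> \<epsilon> * (u - s)"
    if *: "s \<in> T" "u \<in> T" "s \<le> u" "\<bar>s - t\<bar> < \<delta>" "\<bar>u - t\<bar> < \<delta>"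
       "((\<lambda>v. g (ts_floor v)) has_integral i) {s..u}" for s u i
  proof -
    have "((\<lambda>v. g (ts_floor v) - g t) has_integral (i - (u - s) *\<^sub>R g t)) {s..u}"
      using has_integral_diff[OF *(6) has_integral_const_real[of "g t" s u]] *(3) by simp
    moreover have "norm (g (ts_floor v) - g t) \<le> \<epsilon>" if "v \<in> {s..u}" for v
      using ts_floor_between[OF *(1,2) that] \<delta>(2)[of "ts_floor v"] *
      by (auto simp: dist_norm intro!: less_imp_le)
    ultimately show ?thesis
      using has_integral_bound_real[of \<epsilon> "{}" "\<lambda>v. g (ts_floor v) - g t" _ s u] \<open>\<epsilon> > 0\<close> *(3) by simp
  qed
  then show ?thesis using that \<delta>(1) by blast
qed

lemma has_integral_lipschitz:
  fixes g :: "real \<Rightarrow> 'e::euclidean_space"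
  assumes "s \<in> T" "t \<in> T" "s \<le> t" "((\<lambda>v. g (ts_floor v)) has_integral i) {s..t}"
    "\<And>v. v \<in> T \<inter> {s..t} \<Longrightarrow> norm (g v) \<le> C"
  shows "norm i \<le> C * (t - s)"
proof -
  have "0 \<le> C" using assms(5)[of s] assms(1,3) by (auto intro: order_trans[OF norm_ge_zero])
  then show ?thesis
    using has_integral_bound_real[of C "{}" "\<lambda>v. g (ts_floor v)" i s t] assms ts_floor_between[of s t]
    by auto
qed

text \<open>The choice \<open>s = t\<close> in the definition of the delta derivative bounds the
  error by every positive multiple of the graininess at \<open>t\<close>, so the error is
  zero.\<close>

lemma delta_derivative_jump:
  assumes "has_delta_derivative T x D t" "t \<in> T"
  shows "x (sigma T t) = x t + (sigma T t - t) *\<^sub>R D"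
proof -
  have le: "norm (x (sigma T t) - x t - (sigma T t - t) *\<^sub>R D) \<le> \<epsilon> * \<bar>sigma T t - t\<bar>" if "\<epsilon> > 0" for \<epsilon>
    using assms that unfolding has_delta_derivative_def by force
  have "norm (x (sigma T t) - x t - (sigma T t - t) *\<^sub>R D) \<le> e" if "e > 0" for e
    using that le[of "e / \<bar>sigma T t - t\<bar>"] le[of 1] by (cases "sigma T t = t") auto
  then have "norm (x (sigma T t) - x t - (sigma T t - t) *\<^sub>R D) \<le> 0"
    by (rule field_le_epsilon) simp
  then show ?thesis by (simp add: algebra_simps)
qed

text \<open>For \<open>s\<close> near \<open>t\<close> the definition puts \<open>x s\<close> close
  to \<open>x (sigma T t) - (sigma T t - s) *\<^sub>R D\<close>, and by the jump formula this tends
  to \<open>x t\<close>.\<close>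

lemma delta_derivative_continuous:
  assumes D: "has_delta_derivative T x D t" and t: "t \<in> T"
  shows "continuous (at t within T) x"
proof -
  let ?s = "sigma T t"
  have "((\<lambda>s. x ?s - (?s - s) *\<^sub>R D - x s) \<longlongrightarrow> 0) (at t within T)"
  proof (rule tendstoI)
    fix e :: real assume e: "e > 0"
    \<comment> \<open>For \<open>s\<close> within distance 1 of \<open>t\<close> the distance from
      \<open>s\<close> to \<open>?s\<close> is at most \<open>?s - t + 1\<close>, so this
      \<open>k\<close> keeps the error at most \<open>e / 2\<close>.\<close>
    define k where "k = e / 2 / (?s - t + 1)"
    have ge: "t \<le> ?s" by (rule sigma_ge[OF t])
    have k: "k > 0" using e ge by (simp add: k_def)
    then obtain \<delta> where \<delta>: "\<delta> > 0"
      "\<forall>s\<in>T. \<bar>t - s\<bar> < \<delta> \<longrightarrow> norm (x ?s - x s - (?s - s) *\<^sub>R D) \<le> k * \<bar>?s - s\<bar>"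
      using D unfolding has_delta_derivative_def by blast
    show "\<forall>\<^sub>F s in at t within T. dist (x ?s - (?s - s) *\<^sub>R D - x s) 0 < e"
      unfolding eventually_at
    proof (intro exI conjI ballI impI)
      show "0 < min \<delta> 1" using \<delta> by simp
      fix s assume s: "s \<in> T" "s \<noteq> t \<and> dist s t < min \<delta> 1"
      then have "norm (x ?s - x s - (?s - s) *\<^sub>R D) \<le> k * \<bar>?s - s\<bar>"
        using \<delta> by (auto simp: dist_norm)
      also have "\<dots> \<le> k * (?s - t + 1)"
        using s k ge by (intro mult_left_mono) (auto simp: dist_norm)
      also have "\<dots> = e / 2"
        using nonzero_eq_divide_eq[of "?s - t + 1" k "e / 2"] ge by (simp add: k_def)
      also have "\<dots> < e" using e by simp
      finally show "dist (x ?s - (?s - s) *\<^sub>R D - x s) 0 < e" by (simp add: algebra_simps)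
    qed
  qed
  from tendsto_diff[OF tendsto_diff[OF tendsto_const tendsto_scaleR[OF tendsto_diff[OF tendsto_const tendsto_ident_at] tendsto_const]] this, of "x ?s" ?s D]
  have "(x \<longlongrightarrow> x ?s - (?s - t) *\<^sub>R D) (at t within T)" by simp
  then show ?thesis
    using delta_derivative_jump[OF D t] by (simp add: continuous_within)
qed

section \<open>Delta derivatives and integrals\<close>

text \<open>The left neighbour of the hole below \<open>e\<close> is the floor of a number inside
  it. It supplies the predecessor of a left-scattered point in the infimum arguments below.\<close>

lemma gap_below:
  assumes "a \<in> T" "a < e" "\<delta> > 0"
    and gap: "\<And>u. \<lbrakk>u \<in> T; a \<le> u; e - \<delta> < u\<rbrakk> \<Longrightarrow> e \<le> u"
  obtains c where "c \<in> T" "a \<le> c" "c < e" "\<And>u. \<lbrakk>u \<in> T; c < u\<rbrakk> \<Longrightarrow> e \<le> u"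
proof
  let ?m = "max a (e - \<delta> / 2)"
  let ?c = "ts_floor ?m"
  show c: "?c \<in> T" "a \<le> ?c" using assms(1) by (auto intro: ts_floor_in le_ts_floor)
  have "?c \<le> ?m" using assms(1) by (auto intro: ts_floor_le)
  moreover have "?m < e" using assms(2,3) by auto
  ultimately show "?c < e" by (rule order.strict_trans1)
  show "e \<le> u" if u: "u \<in> T" "?c < u" for u
  proof (rule gap[OF u(1)])
    have "?m < u" using le_ts_floor[OF u(1), of ?m] u(2) by (meson not_le)
    then show "a \<le> u" "e - \<delta> < u" using \<open>\<delta> > 0\<close> by auto
  qed
qed

text \<open>Induction along \<open>T\<close>: let \<open>e\<close> be the infimum of the points
  where \<open>z\<close> has moved from \<open>z a\<close> by more than
  \<open>\<epsilon> * (t - a)\<close>. Continuity and the jump condition exclude that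
  \<open>e\<close> is such a point; the derivative bound at a right-dense point, or the gap after a
  right-scattered one, excludes that it is not. Then \<epsilon> tends to 0.\<close>

lemma constant_if_right_derivative_zero:
  fixes z :: "real \<Rightarrow> 'e::real_normed_vector"
  assumes ab: "a \<in> T" "b \<in> T" "a \<le> b"
    and cont: "continuous_on (T \<inter> {a..}) z"
    and jump: "\<And>t. \<lbrakk>t \<in> T; a \<le> t\<rbrakk> \<Longrightarrow> z (sigma T t) = z t"
    and deriv: "\<And>t \<epsilon>. \<lbrakk>right_dense T t; a \<le> t; \<epsilon> > 0\<rbrakk> \<Longrightarrow>
      \<exists>\<delta>>0. \<forall>u\<in>T. t < u \<and> u < t + \<delta> \<longrightarrow> norm (z u - z t) \<le> \<epsilon> * (u - t)"
  shows "z b = z a"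
proof -
  have le: "norm (z b - z a) \<le> \<epsilon> * (b - a)" if \<epsilon>: "\<epsilon> > 0" for \<epsilon>
  proof (rule ccontr)
    assume b: "\<not> norm (z b - z a) \<le> \<epsilon> * (b - a)"
    define S where "S = {t \<in> T. a \<le> t \<and> \<epsilon> * (t - a) < norm (z t - z a)}"
    have "b \<in> S" using b ab by (auto simp: S_def)
    then have ne: "S \<noteq> {}" by blast
    have bdd: "bdd_below S" by (rule bdd_belowI[of _ a]) (auto simp: S_def)
    define e where "e = Inf S"
    have "e \<in> closure S" unfolding e_def by (rule closure_contains_Inf[OF ne bdd])
    also have "closure S \<subseteq> T \<inter> {a..}"
      by (rule closure_minimal) (auto simp: S_def intro: closed closed_Int)
    finally have e: "e \<in> T" "a \<le> e" by auto
    have lower: "e \<le> u" if "u \<in> S" for u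
      unfolding e_def using that bdd by (rule cInf_lower)
    have greatest: "False" if "e < d" "\<And>u. u \<in> S \<Longrightarrow> d \<le> u" for d
      using cInf_greatest[OF ne, of d] that by (auto simp: e_def)
    show False
    proof (cases "e \<in> S")
      case True
      then have "a < e" using e by (cases "a = e") (auto simp: S_def)
      have "((\<lambda>t. norm (z t - z a) - \<epsilon> * (t - a)) \<longlongrightarrow> norm (z e - z a) - \<epsilon> * (e - a)) (at e within (T \<inter> {a..}))"
        using cont e by (intro tendsto_intros) (auto simp: continuous_on_def)
      moreover have "0 < norm (z e - z a) - \<epsilon> * (e - a)" using True by (simp add: S_def)
      ultimately have "\<forall>\<^sub>F t in at e within (T \<inter> {a..}). 0 < norm (z t - z a) - \<epsilon> * (t - a)"
        by (rule order_tendstoD)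
      then obtain \<delta> where \<delta>: "\<delta> > 0" "\<And>t. \<lbrakk>t \<in> T; a \<le> t; t \<noteq> e; dist t e < \<delta>\<rbrakk> \<Longrightarrow> t \<in> S"
        unfolding eventually_at S_def by auto
      \<comment> \<open>Points of \<open>T\<close> just below \<open>e\<close> would lie in
        \<open>S\<close> by continuity, against minimality; so \<open>e\<close> is preceded by a
        gap, across which \<open>z\<close> does not change.\<close>
      have "e \<le> u" if "u \<in> T" "a \<le> u" "e - \<delta> < u" for u
        using \<delta>(2)[of u] lower[of u] that by (force simp: dist_norm)
      then obtain c where c: "c \<in> T" "a \<le> c" "c < e" "\<And>u. \<lbrakk>u \<in> T; c < u\<rbrakk> \<Longrightarrow> e \<le> u"
        using gap_below[OF ab(1) \<open>a < e\<close> \<delta>(1)] by blast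
      then have "z e = z c" using jump[of c] sigma_eqI[OF c(1) e(1) c(3,4)] by simp
      moreover have "c \<notin> S" using lower c(3) by force
      ultimately have "norm (z e - z a) \<le> \<epsilon> * (c - a)" using c by (simp add: S_def)
      also have "\<dots> \<le> \<epsilon> * (e - a)" using \<epsilon> c by simp
      finally show False using True by (simp add: S_def)
    next
      case False
      then have ze: "norm (z e - z a) \<le> \<epsilon> * (e - a)" using e by (simp add: S_def)
      have gt: "e < u" if "u \<in> S" for u using lower[OF that] that False by (cases "u = e") auto
      show False
      proof (cases "right_dense T e")
        case True
        \<comment> \<open>The bounds from \<open>a\<close> to \<open>e\<close> and from
          \<open>e\<close> to \<open>u\<close> add up, so \<open>S\<close> has no point below
          \<open>e + \<delta>\<close>.\<close>
        obtain \<delta> where \<delta>: "\<delta> > 0" "\<And>u. \<lbrakk>u \<in> T; e < u; u < e + \<delta>\<rbrakk> \<Longrightarrow> norm (z u - z e) \<le> \<epsilon> * (u - e)"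
          using deriv[OF True e(2) \<epsilon>] by blast
        show False
        proof (rule greatest)
          show "e < e + \<delta>" using \<delta> by simp
          fix u assume u: "u \<in> S"
          show "e + \<delta> \<le> u"
          proof (rule ccontr)
            assume "\<not> e + \<delta> \<le> u"
            then have "norm (z u - z e) \<le> \<epsilon> * (u - e)" using \<delta>(2) gt[OF u] u by (auto simp: S_def)
            moreover have "norm (z u - z a) \<le> norm (z u - z e) + norm (z e - z a)"
              using norm_triangle_ineq[of "z u - z e" "z e - z a"] by simp
            ultimately have "norm (z u - z a) \<le> \<epsilon> * (u - a)" using ze by (simp add: algebra_simps)
            then show False using u by (simp add: S_def)
          qed
        qed
      next
        case False
        then have "e < sigma T e" using sigma_ge[OF e(1)] e by (auto simp: right_dense_iff)
        then show False
          using greatest[of "sigma T e"] sigma_le gt by (auto simp: S_def)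
      qed
    qed
  qed
  have "norm (z b - z a) \<le> e" if "e > 0" for e
    using that le[of "e / (b - a)"] le[of 1] ab by (cases "a = b") auto
  then have "norm (z b - z a) \<le> 0" by (rule field_le_epsilon) simp
  then show ?thesis by simp
qed

text \<open>Subtracting the indefinite integral from \<open>x\<close> leaves a continuous function
  that does not change across gaps and has right derivative 0 at right-dense points, hence a
  constant one.\<close>

lemma delta_derivative_imp_has_integral:
  fixes x g :: "real \<Rightarrow> 'e::euclidean_space"
  assumes g: "\<And>t. right_dense T t \<Longrightarrow> continuous (at t within T) g"
    and bdd: "\<And>a b. bounded (g ` (T \<inter> {a..b}))"
    and x: "\<And>t. t \<in> T \<Longrightarrow> has_delta_derivative T x (g t) t"
    and ab: "a \<in> T" "b \<in> T" "a \<le> b"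
  shows "((\<lambda>v. g (ts_floor v)) has_integral (x b - x a)) {a..b}"
proof -
  let ?g = "\<lambda>v. g (ts_floor v)"
  have int: "?g integrable_on {s..t}" if "s \<in> T" for s t
  proof -
    obtain C where "\<And>v. v \<in> T \<inter> {s..t} \<Longrightarrow> norm (g v) \<le> C"
      using bdd[of s t] unfolding bounded_iff by blast
    then show ?thesis by (intro integrable_ts_floor[OF g that, of t C]) auto
  qed
  define z where "z t = x t - integral {a..t} ?g" for t
  have diff: "z u - z t = (x u - x t) - integral {t..u} ?g" if "t \<in> T" "u \<in> T" "a \<le> t" "t \<le> u" for t u
    using Henstock_Kurzweil_Integration.integral_combine[OF that(3,4) int[OF ab(1)]] by (simp add: z_def algebra_simps)
  have "z b = z a"
  proof (rule constant_if_right_derivative_zero[OF ab])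
    show "continuous_on (T \<inter> {a..}) z"
      unfolding continuous_on_eq_continuous_within
    proof
      fix t assume t: "t \<in> T \<inter> {a..}"
      have "continuous (at t within (T \<inter> {a..})) x"
        using delta_derivative_continuous[OF x] t by (auto intro: continuous_within_subset)
      moreover have "continuous (at t within (T \<inter> {a..})) (\<lambda>t. integral {a..t} ?g)"
      proof -
        \<comment> \<open>Continuity of the indefinite integral is available on compact intervals;
          ending this one at \<open>t + 1\<close> makes it a neighbourhood of \<open>t\<close> in
          \<open>{a..}\<close>.\<close>
        have "continuous_on {a..t+1} (\<lambda>t. integral {a..t} ?g)"
          by (rule indefinite_integral_continuous_1[OF int[OF ab(1)]])
        then have "continuous (at t within {a..t+1}) (\<lambda>t. integral {a..t} ?g)"
          using t by (auto simp: continuous_on_eq_continuous_within)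
        moreover have "at t within {a..t+1} = at t within {a..}"
          by (rule at_within_nhd[of t "{..<t+1}"]) auto
        ultimately show ?thesis by (auto intro: continuous_within_subset)
      qed
      ultimately show "continuous (at t within (T \<inter> {a..})) z"
        unfolding z_def by (rule continuous_diff)
    qed
    show "z (sigma T t) = z t" if t: "t \<in> T" "a \<le> t" for t
      using diff[OF t(1) sigma_in[OF t(1)] t(2) sigma_ge[OF t(1)]] delta_derivative_jump[OF x[OF t(1)] t(1)]
        integral_unique[OF has_integral_ts_floor_gap[of t "sigma T t" g]] sigma_ge sigma_le t
      by simp
    fix t \<epsilon> assume t: "right_dense T t" "a \<le> t" and \<epsilon>: "(\<epsilon>::real) > 0"
    then have tT: "t \<in> T" and sig: "sigma T t = t" by (auto simp: right_dense_iff)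
    obtain \<delta>1 where \<delta>1: "\<delta>1 > 0"
      "\<And>s u i. \<lbrakk>s \<in> T; u \<in> T; s \<le> u; \<bar>s - t\<bar> < \<delta>1; \<bar>u - t\<bar> < \<delta>1;
       (?g has_integral i) {s..u}\<rbrakk> \<Longrightarrow> norm (i - (u - s) *\<^sub>R g t) \<le> \<epsilon> / 2 * (u - s)"
      using integral_ts_floor_near_right_dense[OF g[OF t(1)], of "\<epsilon> / 2"] \<epsilon> by auto
    obtain \<delta>2 where \<delta>2: "\<delta>2 > 0" "\<And>s. \<lbrakk>s \<in> T; \<bar>t - s\<bar> < \<delta>2\<rbrakk> \<Longrightarrow>
        norm (x t - x s - (t - s) *\<^sub>R g t) \<le> \<epsilon> / 2 * \<bar>t - s\<bar>"
      using x[OF tT] \<epsilon> unfolding has_delta_derivative_def sig by (metis half_gt_zero)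
    show "\<exists>\<delta>>0. \<forall>u\<in>T. t < u \<and> u < t + \<delta> \<longrightarrow> norm (z u - z t) \<le> \<epsilon> * (u - t)"
    proof (intro exI conjI ballI impI)
      show "0 < min \<delta>1 \<delta>2" using \<delta>1 \<delta>2 by simp
      fix u assume u: "u \<in> T" "t < u \<and> u < t + min \<delta>1 \<delta>2"
      have 1: "norm (integral {t..u} ?g - (u - t) *\<^sub>R g t) \<le> \<epsilon> / 2 * (u - t)"
        using \<delta>1 u tT int[OF tT] by (intro \<delta>1(2)) (auto intro: integrable_integral)
      have 2: "norm (x t - x u - (t - u) *\<^sub>R g t) \<le> \<epsilon> / 2 * (u - t)"
        using \<delta>2(2)[of u] u by auto
      \<comment> \<open>Both errors are measured against the same increment
        \<open>(u - t) *\<^sub>R g t\<close>, which cancels; each contributes half of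
        \<epsilon>.\<close>
      have "z u - z t = - (x t - x u - (t - u) *\<^sub>R g t) - (integral {t..u} ?g - (u - t) *\<^sub>R g t)"
        using diff[OF tT u(1) t(2)] u by (simp add: algebra_simps)
      then have "norm (z u - z t) \<le> norm (x t - x u - (t - u) *\<^sub>R g t) + norm (integral {t..u} ?g - (u - t) *\<^sub>R g t)"
        by (metis norm_minus_cancel norm_triangle_ineq4)
      then show "norm (z u - z t) \<le> \<epsilon> * (u - t)" using 1 2 by simp
    qed
  qed
  then have "integral {a..b} ?g = x b - x a" using diff[OF ab(1,2)] ab by (simp add: algebra_simps)
  then show ?thesis using integrable_integral[OF int[OF ab(1)], of b] by simp
qed

text \<open>At a right-dense \<open>t\<close> the local integral estimate applies on both sides. At
  a right-scattered \<open>t\<close> the exact jump reduces the error to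
  \<open>x t - x s - (t - s) *\<^sub>R g t\<close>, which shrinks as \<open>s\<close> approaches
  \<open>t\<close>, while the tolerance stays at least \<epsilon> times the length of the
  gap.\<close>

lemma has_integral_imp_delta_derivative:
  fixes x g :: "real \<Rightarrow> 'e::euclidean_space"
  assumes g: "\<And>t. right_dense T t \<Longrightarrow> continuous (at t within T) g"
    and bdd: "\<And>a b. bounded (g ` (T \<inter> {a..b}))"
    and x: "\<And>s t. \<lbrakk>s \<in> T; t \<in> T; s \<le> t\<rbrakk> \<Longrightarrow> ((\<lambda>v. g (ts_floor v)) has_integral (x t - x s)) {s..t}"
    and t: "t \<in> T"
  shows "has_delta_derivative T x (g t) t"
  unfolding has_delta_derivative_def
proof (intro allI impI)
  fix \<epsilon> :: real assume \<epsilon>: "\<epsilon> > 0"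
  let ?s = "sigma T t"
  have ge: "t \<le> ?s" and sT: "?s \<in> T" using t by (auto intro: sigma_ge sigma_in)
  show "\<exists>\<delta>>0. \<forall>s\<in>T. \<bar>t - s\<bar> < \<delta> \<longrightarrow> norm (x ?s - x s - (?s - s) *\<^sub>R g t) \<le> \<epsilon> * \<bar>?s - s\<bar>"
  proof (cases "right_dense T t")
    case True
    then have sig: "?s = t" by (simp add: right_dense_iff)
    obtain \<delta> where \<delta>: "\<delta> > 0"
      "\<And>s u i. \<lbrakk>s \<in> T; u \<in> T; s \<le> u; \<bar>s - t\<bar> < \<delta>; \<bar>u - t\<bar> < \<delta>;
       ((\<lambda>v. g (ts_floor v)) has_integral i) {s..u}\<rbrakk> \<Longrightarrow> norm (i - (u - s) *\<^sub>R g t) \<le> \<epsilon> * (u - s)"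
      using integral_ts_floor_near_right_dense[OF g[OF True] \<epsilon>] by auto
    show ?thesis unfolding sig
    proof (intro exI[of _ \<delta>] conjI \<delta>(1) ballI impI)
      fix s assume s: "s \<in> T" "\<bar>t - s\<bar> < \<delta>"
      show "norm (x t - x s - (t - s) *\<^sub>R g t) \<le> \<epsilon> * \<bar>t - s\<bar>"
      proof (cases "s \<le> t")
        case True
        then show ?thesis using \<delta>(2)[OF s(1) t True _ _ x[OF s(1) t True]] s \<delta>(1) by simp
      next
        case False
        then have le: "t \<le> s" by simp
        have "x t - x s - (t - s) *\<^sub>R g t = - (x s - x t - (s - t) *\<^sub>R g t)" by (simp add: algebra_simps)
        then show ?thesis using \<delta>(2)[OF t s(1) le _ _ x[OF t s(1) le]] s \<delta>(1) le
          by (simp only: norm_minus_cancel) simp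
      qed
    qed
  next
    case False
    then have gt: "t < ?s" using ge t by (auto simp: right_dense_iff)
    obtain C where C: "\<And>v. v \<in> T \<inter> {t-1..t} \<Longrightarrow> norm (g v) \<le> C"
      using bdd[of "t-1" t] unfolding bounded_iff by blast
    have "0 \<le> C" using C[of t] t by (auto intro: order_trans[OF norm_ge_zero])
    define K where "K = C + norm (g t) + 1"
    have K: "K > 0" using \<open>0 \<le> C\<close> by (auto simp: K_def add_nonneg_pos)
    have jump: "x ?s - x t = (?s - t) *\<^sub>R g t"
      using has_integral_unique[OF x[OF t sT ge] has_integral_ts_floor_gap[of t ?s g]] ge sigma_le t by simp
    show ?thesis
    proof (intro exI conjI ballI impI)
      \<comment> \<open>The bound 1 keeps \<open>s\<close> where \<open>C\<close> bounds
        \<open>g\<close>, the bound \<open>?s - t\<close> excludes points of \<open>T\<close> to the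
        right of \<open>t\<close>, and the last one brings \<open>K * (t - s)\<close> below
        \<open>\<epsilon> * (?s - t)\<close>.\<close>
      show "0 < min (min 1 (?s - t)) (\<epsilon> * (?s - t) / K)" using gt \<epsilon> K by simp
      fix s assume s: "s \<in> T" "\<bar>t - s\<bar> < min (min 1 (?s - t)) (\<epsilon> * (?s - t) / K)"
      then have "s \<le> t" using sigma_le[of s t] by force
      have "norm (x t - x s) \<le> C * (t - s)"
        using s \<open>s \<le> t\<close> by (intro has_integral_lipschitz[OF _ _ _ x] t C) auto
      moreover have "norm ((t - s) *\<^sub>R g t) \<le> norm (g t) * (t - s)" using \<open>s \<le> t\<close> by simp
      ultimately have "norm (x t - x s - (t - s) *\<^sub>R g t) \<le> K * (t - s)"
        using norm_triangle_ineq4[of "x t - x s" "(t - s) *\<^sub>R g t"] \<open>s \<le> t\<close>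
        by (simp add: K_def algebra_simps)
      also have "\<dots> \<le> \<epsilon> * (?s - t)" using s K \<open>s \<le> t\<close> by (simp add: pos_less_divide_eq mult.commute)
      also have "\<dots> \<le> \<epsilon> * \<bar>?s - s\<bar>" using \<epsilon> \<open>s \<le> t\<close> gt by (intro mult_left_mono) auto
      also have "x t - x s - (t - s) *\<^sub>R g t = x ?s - x s - (?s - s) *\<^sub>R g t"
        using jump by (simp add: algebra_simps)
      finally show "norm (x ?s - x s - (?s - s) *\<^sub>R g t) \<le> \<epsilon> * \<bar>?s - s\<bar>" .
    qed
  qed
qed

section \<open>Linear equations\<close>

text \<open>The coefficient takes values in the operators on an arbitrary Euclidean space, so that
  the vector equation and the matrix equation are both instances. Increments are prescribed between
  all pairs of points, which makes restriction to subintervals and evaluation across gaps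
  immediate.\<close>

definition integral_solution ::
    "(real \<Rightarrow> 'e \<Rightarrow>\<^sub>L 'e) \<Rightarrow> real \<Rightarrow> real \<Rightarrow> (real \<Rightarrow> 'e::euclidean_space) \<Rightarrow> bool" where
  "integral_solution L a b x \<longleftrightarrow>
     (\<forall>s\<in>T. \<forall>t\<in>T. a \<le> s \<and> s \<le> t \<and> t \<le> b \<longrightarrow>
       ((\<lambda>u. L (ts_floor u) (x (ts_floor u))) has_integral (x t - x s)) {s..t})"

lemma integral_solutionD:
  "\<lbrakk>integral_solution L a b x; s \<in> T; t \<in> T; a \<le> s; s \<le> t; t \<le> b\<rbrakk> \<Longrightarrow>
     ((\<lambda>u. L (ts_floor u) (x (ts_floor u))) has_integral (x t - x s)) {s..t}"
  unfolding integral_solution_def by blast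

lemma integral_solution_subinterval:
  "\<lbrakk>integral_solution L a b x; a \<le> c; d \<le> b\<rbrakk> \<Longrightarrow> integral_solution L c d x"
  unfolding integral_solution_def by force

lemma integral_solution_diff:
  assumes x: "integral_solution L a b x" and y: "integral_solution L a b y"
  shows "integral_solution L a b (\<lambda>t. x t - y t)"
  unfolding integral_solution_def
proof (intro ballI impI)
  fix s t assume st: "s \<in> T" "t \<in> T" "a \<le> s \<and> s \<le> t \<and> t \<le> b"
  have "(x t - x s) - (y t - y s) = (x t - y t) - (x s - y s)" by simp
  with has_integral_diff[OF integral_solutionD[OF x, of s t] integral_solutionD[OF y, of s t]] st
  show "((\<lambda>u. L (ts_floor u) (x (ts_floor u) - y (ts_floor u))) has_integral
      (x t - y t - (x s - y s))) {s..t}"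
    by (simp add: blinfun.diff_right)
qed

lemma integral_solution_scaleR:
  assumes x: "integral_solution L a b x"
  shows "integral_solution L a b (\<lambda>t. c *\<^sub>R x t)"
  unfolding integral_solution_def
proof (intro ballI impI)
  fix s t assume st: "s \<in> T" "t \<in> T" "a \<le> s \<and> s \<le> t \<and> t \<le> b"
  with has_integral_cmul[OF integral_solutionD[OF x, of s t], of c]
  show "((\<lambda>u. L (ts_floor u) (c *\<^sub>R x (ts_floor u))) has_integral
      (c *\<^sub>R x t - c *\<^sub>R x s)) {s..t}"
    by (simp add: blinfun.scaleR_right scaleR_diff_right)
qed

lemma integral_solution_cong:
  assumes x: "integral_solution L a b x" and eq: "\<And>t. \<lbrakk>t \<in> T; a \<le> t; t \<le> b\<rbrakk> \<Longrightarrow> x t = y t"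
  shows "integral_solution L a b y"
  unfolding integral_solution_def
proof (intro ballI impI)
  fix s t assume st: "s \<in> T" "t \<in> T" "a \<le> s \<and> s \<le> t \<and> t \<le> b"
  have "((\<lambda>u. L (ts_floor u) (y (ts_floor u))) has_integral (x t - x s)) {s..t}"
  proof (rule has_integral_eq)
    show "((\<lambda>u. L (ts_floor u) (x (ts_floor u))) has_integral (x t - x s)) {s..t}"
      using integral_solutionD[OF x, of s t] st by blast
    show "L (ts_floor u) (x (ts_floor u)) = L (ts_floor u) (y (ts_floor u))" if "u \<in> {s..t}" for u
      using ts_floor_between[OF st(1,2) that] eq[of "ts_floor u"] st by simp
  qed
  then show "((\<lambda>u. L (ts_floor u) (y (ts_floor u))) has_integral (y t - y s)) {s..t}"
    using st by (simp add: eq)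
qed

section \<open>Uniqueness forward and backward in time\<close>

lemma integral_solution_bounded:
  assumes x: "integral_solution L a b x" and a: "a \<in> T" "b \<in> T"
  shows "bounded (x ` (T \<inter> {a..b}))"
proof (cases "a \<le> b")
  case True
  let ?F = "\<lambda>u. L (ts_floor u) (x (ts_floor u))"
  have int: "?F integrable_on {a..b}" using integral_solutionD[OF x a] True by auto
  \<comment> \<open>On \<open>T\<close> the solution coincides with a continuous function on the
    whole interval, whose image is compact.\<close>
  have "compact ((\<lambda>t. x a + integral {a..t} ?F) ` {a..b})"
    by (intro compact_continuous_image continuous_intros indefinite_integral_continuous_1[OF int]) simp
  moreover have "x ` (T \<inter> {a..b}) \<subseteq> (\<lambda>t. x a + integral {a..t} ?F) ` {a..b}"
  proof
    fix y assume "y \<in> x ` (T \<inter> {a..b})"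
    then obtain t where t: "t \<in> T" "a \<le> t" "t \<le> b" "y = x t" by auto
    then have "y = x a + integral {a..t} ?F"
      using integral_unique[OF integral_solutionD[OF x a(1) t(1)]] by simp
    then show "y \<in> (\<lambda>t. x a + integral {a..t} ?F) ` {a..b}" using t by auto
  qed
  ultimately show ?thesis using bounded_subset compact_imp_bounded by blast
qed simp

text \<open>On an interval shorter than \<open>1 / (2 M)\<close> the equation forces \<open>K \<le> K / 2\<close> for the supremum \<open>K\<close>
  of a solution vanishing somewhere. Graininess plays no role in this estimate, so it works in both
  directions of time.\<close>

lemma integral_solution_zero_near:
  assumes z: "integral_solution L c d z" and cd: "c \<in> T" "d \<in> T"
    and M: "M > 0" "\<And>t. \<lbrakk>t \<in> T; c \<le> t; t \<le> d\<rbrakk> \<Longrightarrow> norm (L t) \<le> M" and short: "2 * M * (d - c) \<le> 1"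
    and w: "w \<in> T" "c \<le> w" "w \<le> d" "z w = 0"
    and t: "t \<in> T" "c \<le> t" "t \<le> d"
  shows "z t = 0"
proof -
  let ?S = "T \<inter> {c..d}"
  define K where "K = (SUP u\<in>?S. norm (z u))"
  have bdd: "bdd_above ((\<lambda>u. norm (z u)) ` ?S)"
  proof -
    obtain B where "\<forall>u\<in>z ` ?S. norm u \<le> B"
      using integral_solution_bounded[OF z cd] unfolding bounded_iff by blast
    then show ?thesis by (intro bdd_aboveI2[of _ _ B]) simp
  qed
  have le: "norm (z u) \<le> K" if "u \<in> ?S" for u
    unfolding K_def by (rule cSUP_upper[OF that bdd])
  have bound: "norm (L u (z u)) \<le> M * K" if "u \<in> ?S" for u
  proof -
    have "norm (L u (z u)) \<le> norm (L u) * norm (z u)" by (rule norm_blinfun)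
    also have "\<dots> \<le> M * K" using that M le by (intro mult_mono) auto
    finally show ?thesis .
  qed
  have half: "norm (z u) \<le> K / 2" if u: "u \<in> ?S" for u
  proof -
    have K: "0 \<le> K" using order_trans[OF norm_ge_zero le[OF u]] .
    have step: "norm (z q - z p) \<le> K / 2" if "p \<in> T" "q \<in> T" "c \<le> p" "p \<le> q" "q \<le> d" for p q
    proof -
      have "norm (z q - z p) \<le> (M * K) * (q - p)"
        using that bound
        by (intro has_integral_lipschitz[where g = "\<lambda>u. L u (z u)", OF that(1,2,4) integral_solutionD[OF z]]) auto
      also have "\<dots> \<le> (M * K) * (d - c)" using that M K by (intro mult_left_mono) auto
      also have "\<dots> = K / 2 * (2 * M * (d - c))" by simp
      also have "\<dots> \<le> K / 2 * 1" using short K by (intro mult_left_mono) auto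
      finally show ?thesis by simp
    qed
    show ?thesis
      using step[of u w] step[of w u] u w by (cases "u \<le> w") (auto simp: norm_minus_commute)
  qed
  have "?S \<noteq> {}" using t by auto
  then have "K \<le> K / 2" unfolding K_def[symmetric] using half by (subst K_def) (rule cSUP_least)
  moreover have "norm (z t) \<le> K" using le[of t] t by simp
  ultimately have "norm (z t) \<le> 0" by linarith
  then show ?thesis by simp
qed

text \<open>The integrand is constant across a gap, so the solution makes one exact Euler step
  there; regressivity will make this step injective.\<close>

lemma integral_solution_gap:
  assumes z: "integral_solution L a b z" and "c \<in> T" "d \<in> T" "a \<le> c" "c < d" "d \<le> b"
    and gap: "\<And>u. \<lbrakk>u \<in> T; c < u\<rbrakk> \<Longrightarrow> d \<le> u"
  shows "z d = z c + mu T c *\<^sub>R L c (z c)"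
proof -
  have "z d - z c = (d - c) *\<^sub>R L c (z c)"
    using assms by (intro has_integral_unique[OF integral_solutionD[OF z]
        has_integral_ts_floor_gap[where g = "\<lambda>u. L u (z u)"]]) auto
  then show ?thesis using sigma_eqI[of c d] assms by (simp add: mu_def algebra_simps)
qed

lemma rd_continuous_norm_bound:
  fixes L :: "real \<Rightarrow> 'a::real_normed_vector"
  assumes "rd_continuous T L"
  obtains M where "M > 0" "\<And>t. \<lbrakk>t \<in> T; a \<le> t; t \<le> b\<rbrakk> \<Longrightarrow> norm (L t) \<le> M"
  using rd_continuous_bounded[OF assms, of a b] unfolding bounded_pos by auto

text \<open>The short-interval estimate carries a zero over any distance up to \<open>h\<close>, so
  a first nonzero value on either side of \<open>w\<close> can only occur at the far end of a gap.
  There the Euler step decides: forward it maps 0 to 0, backward it is injective by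
  \<open>reg\<close>.\<close>

lemma integral_solution_zero:
  assumes z: "integral_solution L a b z" and rd: "rd_continuous T L"
    and reg: "\<forall>t\<in>T. \<forall>v. v + mu T t *\<^sub>R L t v = 0 \<longrightarrow> v = 0"
    and ab: "a \<in> T" "b \<in> T" and w: "w \<in> T" "a \<le> w" "w \<le> b" "z w = 0"
    and t: "t \<in> T" "a \<le> t" "t \<le> b"
  shows "z t = 0"
proof -
  obtain M where M: "M > 0" "\<And>t. \<lbrakk>t \<in> T; a \<le> t; t \<le> b\<rbrakk> \<Longrightarrow> norm (L t) \<le> M"
    using rd_continuous_norm_bound[OF rd] by blast
  define h where "h = 1 / (2 * M)"
  have h: "h > 0" using M by (simp add: h_def)
  have near: "z v = 0" if "u \<in> T" "a \<le> u" "u \<le> b" "z u = 0" "v \<in> T" "a \<le> v" "v \<le> b" "\<bar>v - u\<bar> \<le> h" for u v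
  proof (rule integral_solution_zero_near[where c = "min u v" and d = "max u v" and M = M and w = u])
    show "integral_solution L (min u v) (max u v) z"
      by (rule integral_solution_subinterval[OF z]) (use that in auto)
    have "max u v - min u v \<le> h" using that by auto
    then show "2 * M * (max u v - min u v) \<le> 1" using M by (simp add: h_def pos_le_divide_eq mult.commute)
  qed (use that M in \<open>auto simp: min_def max_def split: if_splits\<close>)
  show ?thesis
  proof (rule ccontr)
    assume nz: "z t \<noteq> 0"
    consider "w < t" | "t < w" using nz w by (cases w t rule: linorder_cases) auto
    then show False
    proof cases
      case 1
      define S where "S = {u \<in> T. w \<le> u \<and> u \<le> b \<and> z u \<noteq> 0}"
      define e where "e = Inf S"
      have "t \<in> S" using 1 nz t by (auto simp: S_def)
      then have ne: "S \<noteq> {}" by blast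
      have bdd: "bdd_below S" by (rule bdd_belowI[of _ w]) (auto simp: S_def)
      have "e \<in> closure S" unfolding e_def by (rule closure_contains_Inf[OF ne bdd])
      also have "closure S \<subseteq> T \<inter> {w..b}"
        by (rule closure_minimal) (auto simp: S_def intro: closed closed_Int)
      finally have e: "e \<in> T" "w \<le> e" "e \<le> b" by auto
      have lower: "e \<le> u" if "u \<in> S" for u
        unfolding e_def using that bdd by (rule cInf_lower)
      show False
      proof (cases "z e = 0")
        case True
        have "e + h \<le> u" if "u \<in> S" for u
          using near[of e u] lower[OF that] that True e w by (force simp: S_def)
        then have "e + h \<le> e" unfolding e_def by (intro cInf_greatest[OF ne]) (simp add: e_def)
        then show False using h by simp
      next
        case False
        then have "w < e" using e w by (cases "w = e") auto
        \<comment> \<open>A point of \<open>T\<close> in this range below \<open>e\<close> would be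
          a zero within distance \<open>h\<close> and force \<open>z e = 0\<close>; hence
          \<open>e\<close> has a predecessor \<open>c\<close>, at which \<open>z\<close>
          vanishes.\<close>
        have "e \<le> u" if "u \<in> T" "w \<le> u" "e - h < u" for u
        proof (rule ccontr)
          assume "\<not> e \<le> u"
          then have "z u = 0" using lower[of u] that e by (auto simp: S_def)
          then have "z e = 0" using near[of u e] that e w \<open>\<not> e \<le> u\<close> by auto
          then show False using False by simp
        qed
        then obtain c where c: "c \<in> T" "w \<le> c" "c < e" "\<And>u. \<lbrakk>u \<in> T; c < u\<rbrakk> \<Longrightarrow> e \<le> u"
          using gap_below[OF w(1) \<open>w < e\<close> h] by blast
        have "z c = 0" using lower[of c] c e by (auto simp: S_def)
        then have "z e = 0" using integral_solution_gap[OF z c(1) e(1) _ c(3) e(3) c(4)] c w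
          by (simp add: blinfun.zero_right)
        then show False using False by simp
      qed
    next
      case 2
      define S where "S = {u \<in> T. a \<le> u \<and> u \<le> w \<and> z u \<noteq> 0}"
      define e where "e = Sup S"
      have "t \<in> S" using 2 nz t by (auto simp: S_def)
      then have ne: "S \<noteq> {}" by blast
      have bdd: "bdd_above S" by (rule bdd_aboveI[of _ w]) (auto simp: S_def)
      have "e \<in> closure S" unfolding e_def by (rule closure_contains_Sup[OF ne bdd])
      also have "closure S \<subseteq> T \<inter> {a..w}"
        by (rule closure_minimal) (auto simp: S_def intro: closed closed_Int)
      finally have e: "e \<in> T" "a \<le> e" "e \<le> w" by auto
      have upper: "u \<le> e" if "u \<in> S" for u
        unfolding e_def using that bdd by (rule cSup_upper)
      show False
      proof (cases "z e = 0")
        case True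
        have "u \<le> e - h" if "u \<in> S" for u
          using near[of e u] upper[OF that] that True e w by (force simp: S_def)
        then have "e \<le> e - h" unfolding e_def by (intro cSup_least[OF ne]) (simp add: e_def)
        then show False using h by simp
      next
        case False
        then have "e < w" using e w by (cases "w = e") auto
        let ?d = "sigma T e"
        have d: "?d \<in> T" "e \<le> ?d" "?d \<le> w" using e \<open>e < w\<close> w by (auto intro: sigma_in sigma_ge sigma_le)
        have zero: "z u = 0" if "u \<in> T" "e < u" "u \<le> w" for u
          using upper[of u] that e by (auto simp: S_def)
        \<comment> \<open>If \<open>e\<close> were right-dense, zeros of \<open>z\<close> would lie
          arbitrarily close to its right and force \<open>z e = 0\<close>.\<close>
        have "e < ?d"
        proof (rule ccontr)
          assume "\<not> e < ?d"
          then have "?d = e" using d by simp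
          then have "Inf {s \<in> T. e < s} < e + h" using h unbounded[OF e(1)] by (auto simp: sigma_def)
          then obtain u where u: "u \<in> T" "e < u" "u < e + h"
            using cInf_lessD[of "{s \<in> T. e < s}" "e + h"] unbounded[OF e(1)] by auto
          \<comment> \<open>The point \<open>u\<close> may lie beyond \<open>w\<close>, where
            nothing is known about \<open>z\<close>; capping it at \<open>w\<close> keeps it among
            the zeros.\<close>
          then have "min u w \<in> T" "e < min u w" "min u w \<le> w" "min u w < e + h"
            using w \<open>e < w\<close> by (auto simp: min_def)
          then have "z e = 0" using near[of "min u w" e] zero[of "min u w"] e w by auto
          then show False using False by simp
        qed
        then have "0 = z e + mu T e *\<^sub>R L e (z e)"
          using integral_solution_gap[OF z e(1) d(1) e(2) _ _ sigma_le] zero[OF d(1) _ d(3)] d w by auto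
        then show False using bspec[OF reg e(1)] False by metis
      qed
    qed
  qed
qed

text \<open>The fixed point \<open>\<phi>\<close> is the solution divided by \<open>E t = exp (2 M (t - a))\<close>; this weight makes the
  integral operator \<open>P\<close> a contraction with constant \<open>1 / 2\<close> on the whole of \<open>[a, b]\<close>.\<close>

lemma exists_integral_solution_forward:
  fixes L :: "real \<Rightarrow> 'e::euclidean_space \<Rightarrow>\<^sub>L 'e"
  assumes rd: "rd_continuous T L" and ab: "a \<in> T" "b \<in> T" "a \<le> b"
  obtains x where "integral_solution L a b x" "x a = v"
proof -
  obtain M where M: "M > 0" "\<And>t. \<lbrakk>t \<in> T; a \<le> t; t \<le> b\<rbrakk> \<Longrightarrow> norm (L t) \<le> M"
    using rd_continuous_norm_bound[OF rd] by blast
  define w where "w = 2 * M"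
  have w: "w > 0" using M by (simp add: w_def)
  define E where "E t = exp (w * (t - a))" for t
  have E_pos: "E t > 0" and E_nz: "E t \<noteq> 0" for t by (auto simp: E_def)
  have E_cont: "continuous_on S E" for S unfolding E_def by (intro continuous_intros)
  have E_mono: "E s \<le> E t" if "s \<le> t" for s t using that w by (simp add: E_def)
  \<comment> \<open>Since \<phi> stands for the solution divided by \<open>E\<close>, this is the
    right-hand side of the equation for the unweighted function.\<close>
  define h where "h \<phi> t = E t *\<^sub>R L t (\<phi> t)" for \<phi> :: "real \<Rightarrow> 'e" and t
  define I where "I \<phi> c = integral {a..c} (\<lambda>u. h \<phi> (ts_floor u))" for \<phi> c
  define Q where "Q \<phi> c = (1 / E c) *\<^sub>R (v + I \<phi> c)" for \<phi> c
  \<comment> \<open>The Banach space consists of bounded continuous functions on the whole line;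
    composing with \<open>clip\<close> extends a function on \<open>{a..b}\<close> constantly on
    both sides.\<close>
  define clip where "clip u = max a (min b u)" for u
  have clip: "a \<le> clip u" "clip u \<le> b" for u using ab by (auto simp: clip_def)
  have int: "(\<lambda>u. h (apply_bcontfun \<phi>) (ts_floor u)) integrable_on {a..c}" if "c \<le> b" for \<phi> c
  proof (rule integrable_ts_floor[OF _ ab(1)])
    show "continuous (at t within T) (h (apply_bcontfun \<phi>))" if "right_dense T t" for t
    proof -
      have "continuous (at t within T) L" using that rd by (simp add: rd_continuous_def)
      moreover have "continuous (at t within T) (apply_bcontfun \<phi>)"
        using continuous_on_apply_bcontfun[of UNIV \<phi>]
        by (auto simp: continuous_on_eq_continuous_within intro: continuous_within_subset)
      ultimately show ?thesis unfolding h_def E_def by (intro continuous_intros)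
    qed
    fix t assume t: "t \<in> T" "a \<le> t" "t \<le> c"
    have "norm (h (apply_bcontfun \<phi>) t) \<le> E t * (norm (L t) * norm (\<phi> t))"
      using E_pos[of t] norm_blinfun[of "L t" "\<phi> t"] by (simp add: h_def)
    also have "\<dots> \<le> E b * (M * norm \<phi>)"
      using t \<open>c \<le> b\<close> M E_mono[of t b] E_pos[of t] norm_bounded[of \<phi> t] by (intro mult_mono) auto
    finally show "norm (h (apply_bcontfun \<phi>) t) \<le> E b * (M * norm \<phi>)" .
  qed
  have Q_cont: "continuous_on {a..b} (Q (apply_bcontfun \<phi>))" for \<phi>
    unfolding Q_def I_def using E_nz
    by (intro continuous_intros E_cont indefinite_integral_continuous_1 int) auto
  have Q_bcontfun: "(\<lambda>u. Q (apply_bcontfun \<phi>) (clip u)) \<in> bcontfun" for \<phi>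
  proof -
    have "continuous_on UNIV (\<lambda>u. Q (apply_bcontfun \<phi>) (clip u))"
      using clip by (intro continuous_on_compose2[OF Q_cont]) (auto simp: clip_def intro!: continuous_intros)
    moreover have "compact (Q (apply_bcontfun \<phi>) ` {a..b})"
      by (intro compact_continuous_image Q_cont) simp
    then have "bounded (range (\<lambda>u. Q (apply_bcontfun \<phi>) (clip u)))"
      by (rule bounded_subset[OF compact_imp_bounded]) (use clip in auto)
    ultimately show ?thesis by (simp add: bcontfun_def)
  qed
  define P where "P \<phi> = Bcontfun (\<lambda>u. Q (apply_bcontfun \<phi>) (clip u))" for \<phi>
  have P: "apply_bcontfun (P \<phi>) u = Q (apply_bcontfun \<phi>) (clip u)" for \<phi> u
    unfolding P_def by (simp add: Bcontfun_inverse[OF Q_bcontfun])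
  have "dist (P \<phi>) (P \<psi>) \<le> 1/2 * dist \<phi> \<psi>" for \<phi> \<psi>
  proof (rule dist_bound)
    fix u
    let ?c = "clip u" and ?d = "dist \<phi> \<psi>"
    let ?k = "\<lambda>s. h (apply_bcontfun \<phi>) (ts_floor s) - h (apply_bcontfun \<psi>) (ts_floor s)"
    have k: "?k integrable_on {a..?c}" by (intro integrable_diff int clip)
    have E_int: "(E has_integral (E ?c / w - E a / w)) {a..?c}"
    proof (rule fundamental_theorem_of_calculus)
      show "((\<lambda>s. E s / w) has_vector_derivative E s) (at s within {a..?c})" for s
        unfolding E_def using w
        by (auto intro!: derivative_eq_intros simp flip: has_real_derivative_iff_has_vector_derivative)
    qed (rule clip)
    \<comment> \<open>As \<open>E\<close> increases, its value at the floor of \<open>s\<close> is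
      at most \<open>E s\<close>. The integral of \<open>E\<close> up to \<open>?c\<close> is at
      most \<open>E ?c / w\<close>, and \<open>M / w = 1 / 2\<close> is the contraction
      constant.\<close>
    have "norm (integral {a..?c} ?k) \<le> integral {a..?c} (\<lambda>s. M * ?d * E s)"
    proof (rule integral_norm_bound_integral[OF k])
      show "(\<lambda>s. M * ?d * E s) integrable_on {a..?c}" using E_int by (intro integrable_on_mult_right) auto
      fix s assume s: "s \<in> {a..?c}"
      let ?f = "ts_floor s"
      have f: "?f \<in> T" "a \<le> ?f" "?f \<le> s" "s \<le> b"
        using s clip(2)[of u] ab ts_floor_in[of a s] le_ts_floor[of a s] ts_floor_le[of a s] by auto
      have "norm (?k s) = E ?f * norm (L ?f (\<phi> ?f - \<psi> ?f))"
        using E_pos[of ?f] by (simp add: h_def blinfun.diff_right flip: scaleR_diff_right)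
      also have "\<dots> \<le> E s * (M * ?d)"
      proof (intro mult_mono E_mono f)
        have "norm (L ?f (\<phi> ?f - \<psi> ?f)) \<le> norm (L ?f) * norm (\<phi> ?f - \<psi> ?f)" by (rule norm_blinfun)
        also have "\<dots> \<le> M * ?d"
          using M f dist_bounded[of \<phi> ?f \<psi>] by (intro mult_mono) (auto simp: dist_norm)
        finally show "norm (L ?f (\<phi> ?f - \<psi> ?f)) \<le> M * ?d" .
      qed (use E_pos[of s] in auto)
      finally show "norm (?k s) \<le> M * ?d * E s" by (simp add: mult_ac)
    qed
    also have "\<dots> = M * ?d * (E ?c / w - E a / w)" using integral_unique[OF E_int] by simp
    also have "\<dots> \<le> M * ?d * (E ?c / w)" using M w E_pos[of a] by (intro mult_left_mono) auto
    also have "\<dots> = 1/2 * ?d * E ?c" using M by (simp add: w_def)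
    finally have *: "norm (integral {a..?c} ?k) \<le> 1/2 * ?d * E ?c" .
    have "Q (apply_bcontfun \<phi>) ?c - Q (apply_bcontfun \<psi>) ?c = (1 / E ?c) *\<^sub>R integral {a..?c} ?k"
      by (simp add: Q_def I_def Henstock_Kurzweil_Integration.integral_diff[OF int[OF clip(2)] int[OF clip(2)]] flip: scaleR_diff_right)
    then have "dist (P \<phi> u) (P \<psi> u) = norm (integral {a..?c} ?k) / E ?c"
      using E_pos[of ?c] by (simp add: P dist_norm)
    also have "\<dots> \<le> 1/2 * ?d" using * E_pos[of ?c] by (simp add: pos_divide_le_eq)
    finally show "dist (P \<phi> u) (P \<psi> u) \<le> 1/2 * ?d" .
  qed
  then obtain \<phi> where \<phi>: "P \<phi> = \<phi>"
    using banach_fix_type[of "1/2" P] by auto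
  define x where "x t = E t *\<^sub>R \<phi> t" for t
  have x: "x t = v + I \<phi> t" if "a \<le> t" "t \<le> b" for t
  proof -
    have "clip t = t" using that by (auto simp: clip_def)
    then have "\<phi> t = Q \<phi> t" using P[of \<phi> t] by (simp add: \<phi>)
    then show ?thesis using E_nz[of t] by (simp add: x_def Q_def)
  qed
  show thesis
  proof
    show "x a = v" using x[of a] ab by (simp add: I_def)
    show "integral_solution L a b x"
      unfolding integral_solution_def
    proof (intro ballI impI)
      fix s t assume st: "s \<in> T" "t \<in> T" "a \<le> s \<and> s \<le> t \<and> t \<le> b"
      have h: "h \<phi> = (\<lambda>u. L u (x u))" by (simp add: fun_eq_iff h_def x_def blinfun.scaleR_right)
      have "integral {s..t} (\<lambda>u. h \<phi> (ts_floor u)) = x t - x s"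
        using Henstock_Kurzweil_Integration.integral_combine[of a s t, OF _ _ int[of t \<phi>]] st x[of s] x[of t]
        by (simp add: I_def algebra_simps)
      moreover have "(\<lambda>u. h \<phi> (ts_floor u)) integrable_on {s..t}"
        using st by (intro integrable_on_subinterval[OF int[of t \<phi>]]) auto
      ultimately show "((\<lambda>u. L (ts_floor u) (x (ts_floor u))) has_integral (x t - x s)) {s..t}"
        using integrable_integral[of "\<lambda>u. h \<phi> (ts_floor u)" "{s..t}"] by (simp add: h)
    qed
  qed
qed

text \<open>Only forward solving is available, so the state at \<open>w\<close> is hit by choosing
  the state at \<open>a\<close>: uniqueness makes the map between these states linear and injective,
  and finite dimension makes it surjective.\<close>

lemma exists_integral_solution:
  fixes L :: "real \<Rightarrow> 'e::euclidean_space \<Rightarrow>\<^sub>L 'e"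
  assumes rd: "rd_continuous T L"
    and reg: "\<forall>t\<in>T. \<forall>v. v + mu T t *\<^sub>R L t v = 0 \<longrightarrow> v = 0"
    and ab: "a \<in> T" "b \<in> T" "w \<in> T" "a \<le> w" "w \<le> b"
  obtains x where "integral_solution L a b x" "x w = v"
proof -
  have "\<forall>v. \<exists>x. integral_solution L a b x \<and> x a = v"
    using exists_integral_solution_forward[OF rd ab(1,2)] ab(4,5) by (metis order_trans)
  then obtain X where X: "\<And>v. integral_solution L a b (X v)" "\<And>v. X v a = v" by metis
  have zero: "z w = 0" if "integral_solution L a b z" "z a = 0" for z
    using integral_solution_zero[OF that(1) rd reg ab(1,2,1) _ _ that(2) ab(3)] ab(4,5) by auto
  have "linear (\<lambda>v. X v w)"
  proof
    fix u v
    have "integral_solution L a b (\<lambda>t. (X (u + v) t - X u t) - X v t)"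
      by (intro integral_solution_diff X)
    from zero[OF this] show "X (u + v) w = X u w + X v w" by (simp add: X algebra_simps)
  next
    fix c :: real and v
    have "integral_solution L a b (\<lambda>t. X (c *\<^sub>R v) t - c *\<^sub>R X v t)"
      by (intro integral_solution_diff integral_solution_scaleR X)
    from zero[OF this] show "X (c *\<^sub>R v) w = c *\<^sub>R X v w" by (simp add: X)
  qed
  moreover from this have "inj (\<lambda>v. X v w)"
  proof (subst linear_injective_0, simp, intro allI impI)
    fix v assume "X v w = 0"
    then have "X v a = 0"
      using integral_solution_zero[OF X(1) rd reg ab(1,2,3,4,5) _ ab(1)] ab(4,5) by auto
    then show "v = 0" by (simp add: X)
  qed
  ultimately have "surj (\<lambda>v. X v w)" using linear_injective_imp_surjective by blast
  then obtain u where "X u w = v" by (metis surjD)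
  then show thesis using that X(1) by blast
qed

text \<open>Solutions on the intervals spanned by \<open>w\<close> and \<open>t\<close> are glued by
  evaluating each at its own \<open>t\<close>; uniqueness shows that they agree with a single
  solution on any larger interval.\<close>

lemma exists_global_integral_solution:
  fixes L :: "real \<Rightarrow> 'e::euclidean_space \<Rightarrow>\<^sub>L 'e"
  assumes rd: "rd_continuous T L"
    and reg: "\<forall>t\<in>T. \<forall>v. v + mu T t *\<^sub>R L t v = 0 \<longrightarrow> v = 0"
    and w: "w \<in> T"
  shows "\<exists>x. (\<forall>a\<in>T. \<forall>b\<in>T. integral_solution L a b x) \<and> x w = v"
proof -
  define y where "y t = (SOME x. integral_solution L (min t w) (max t w) x \<and> x w = v)" for t
  have y: "integral_solution L (min t w) (max t w) (y t)" "y t w = v" if "t \<in> T" for t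
  proof -
    have tw: "min t w \<in> T" "max t w \<in> T" using that w by (auto simp: min_def max_def)
    obtain z where "integral_solution L (min t w) (max t w) z" "z w = v"
      using exists_integral_solution[OF rd reg tw w min.cobounded2 max.cobounded2] by blast
    then have "\<exists>x. integral_solution L (min t w) (max t w) x \<and> x w = v" by blast
    from someI_ex[OF this] have "integral_solution L (min t w) (max t w) (y t) \<and> y t w = v"
      by (simp only: y_def)
    then show "integral_solution L (min t w) (max t w) (y t)" "y t w = v" by auto
  qed
  define x where "x t = y t t" for t
  show ?thesis
  proof (intro exI[of _ x] conjI ballI)
    show "x w = v" using y[OF w] by (simp add: x_def)
    fix a b assume ab: "a \<in> T" "b \<in> T"
    \<comment> \<open>The interval is enlarged to contain \<open>w\<close>, so that its solution can
      be compared with the local ones through their common state \<open>v\<close>.\<close>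
    let ?a = "min a w" and ?b = "max b w"
    have ab': "?a \<in> T" "?b \<in> T" "?a \<le> w" "w \<le> ?b" using ab w by (auto simp: min_def max_def)
    obtain z where z: "integral_solution L ?a ?b z" "z w = v"
      using exists_integral_solution[OF rd reg ab'(1,2) w ab'(3,4)] by blast
    have "z t = x t" if t: "t \<in> T" "?a \<le> t" "t \<le> ?b" for t
    proof -
      have tw: "min t w \<in> T" "max t w \<in> T" using t w by (auto simp: min_def max_def)
      have "integral_solution L (min t w) (max t w) z"
        using t ab' by (intro integral_solution_subinterval[OF z(1)]) auto
      then have "integral_solution L (min t w) (max t w) (\<lambda>s. z s - y t s)"
        using y[OF t(1)] by (intro integral_solution_diff)
      from integral_solution_zero[OF this rd reg tw w _ _ _ t(1)]
      have "z t - y t t = 0" using z(2) y(2)[OF t(1)] by auto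
      then show ?thesis by (simp add: x_def)
    qed
    then have "integral_solution L ?a ?b x" by (rule integral_solution_cong[OF z(1)])
    then show "integral_solution L a b x" by (rule integral_solution_subinterval) auto
  qed
qed

section \<open>Equivalence of the delta equation and its integral form\<close>

definition delta_solution :: "(real \<Rightarrow> 'e \<Rightarrow>\<^sub>L 'e) \<Rightarrow> (real \<Rightarrow> 'e::euclidean_space) \<Rightarrow> bool" where
  "delta_solution L x \<longleftrightarrow> (\<forall>t\<in>T. has_delta_derivative T x (L t (x t)) t)"

text \<open>Delta differentiability makes \<open>x\<close> continuous, hence bounded on compact
  parts of \<open>T\<close>, so the right-hand side is continuous at right-dense points and bounded,
  as the integral formula requires.\<close>

lemma delta_solution_imp_integral_solution:
  fixes L :: "real \<Rightarrow> 'e::euclidean_space \<Rightarrow>\<^sub>L 'e"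
  assumes rd: "rd_continuous T L" and x: "delta_solution L x"
  shows "integral_solution L a b x"
proof -
  have D: "has_delta_derivative T x (L t (x t)) t" if "t \<in> T" for t
    using x that by (simp add: delta_solution_def)
  have cont: "continuous (at t within T) x" if "t \<in> T" for t
    by (rule delta_derivative_continuous[OF D that]) fact
  have g: "continuous (at t within T) (\<lambda>u. L u (x u))" if "right_dense T t" for t
    using rd that cont[of t] by (auto intro!: continuous_intros simp: rd_continuous_def right_dense_def)
  have bdd: "bounded ((\<lambda>u. L u (x u)) ` (T \<inter> {a..b}))" for a b
  proof -
    obtain M where M: "M > 0" "\<And>t. \<lbrakk>t \<in> T; a \<le> t; t \<le> b\<rbrakk> \<Longrightarrow> norm (L t) \<le> M"
      using rd_continuous_norm_bound[OF rd] by blast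
    have "continuous_on (T \<inter> {a..b}) x"
      using cont by (auto simp: continuous_on_eq_continuous_within intro: continuous_within_subset)
    then have "bounded (x ` (T \<inter> {a..b}))"
      by (intro compact_imp_bounded compact_continuous_image) (simp_all add: closed closed_Int_compact)
    then obtain K where K: "\<And>t. t \<in> T \<inter> {a..b} \<Longrightarrow> norm (x t) \<le> K" unfolding bounded_iff by blast
    have "norm (L t (x t)) \<le> M * K" if t: "t \<in> T \<inter> {a..b}" for t
    proof -
      have "norm (L t (x t)) \<le> norm (L t) * norm (x t)" by (rule norm_blinfun)
      also have "\<dots> \<le> M * K" using M t K by (intro mult_mono) auto
      finally show ?thesis .
    qed
    then show ?thesis unfolding bounded_iff by blast
  qed
  show ?thesis unfolding integral_solution_def
    using delta_derivative_imp_has_integral[OF g bdd D] by blast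
qed

text \<open>The endpoints can be replaced by the least and the greatest point of
  \<open>T \<inter> {a..b}\<close>. This bridges estimates between points of \<open>T\<close> and
  the arbitrary bounds in the differentiation lemma.\<close>

lemma bounded_image_Icc:
  assumes "\<And>a b. \<lbrakk>a \<in> T; b \<in> T\<rbrakk> \<Longrightarrow> bounded (f ` (T \<inter> {a..b}))"
  shows "bounded (f ` (T \<inter> {a..b}))"
proof (cases "T \<inter> {a..b} = {}")
  case False
  have "compact (T \<inter> {a..b})" using closed by (simp add: closed_Int_compact)
  then obtain c d where "c \<in> T \<inter> {a..b}" "d \<in> T \<inter> {a..b}"
    "\<forall>t\<in>T \<inter> {a..b}. c \<le> t" "\<forall>t\<in>T \<inter> {a..b}. t \<le> d"
    using compact_attains_inf compact_attains_sup False by metis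
  then have "bounded (f ` (T \<inter> {c..d}))" "f ` (T \<inter> {a..b}) \<subseteq> f ` (T \<inter> {c..d})"
    using assms by auto
  then show ?thesis by (rule bounded_subset)
qed simp

lemma integral_solution_imp_delta_solution:
  fixes L :: "real \<Rightarrow> 'e::euclidean_space \<Rightarrow>\<^sub>L 'e"
  assumes rd: "rd_continuous T L"
    and x: "\<And>a b. \<lbrakk>a \<in> T; b \<in> T\<rbrakk> \<Longrightarrow> integral_solution L a b x"
  shows "delta_solution L x"
proof -
  let ?g = "\<lambda>u. L u (x u)"
  have int: "((\<lambda>v. ?g (ts_floor v)) has_integral (x t - x s)) {s..t}"
    if "s \<in> T" "t \<in> T" "s \<le> t" for s t
    using integral_solutionD[OF x[OF that(1,2)] that(1,2)] that(3) by simp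
  have bdd: "bounded (?g ` (T \<inter> {a..b}))" for a b
  proof -
    obtain M where M: "M > 0" "\<And>t. \<lbrakk>t \<in> T; a \<le> t; t \<le> b\<rbrakk> \<Longrightarrow> norm (L t) \<le> M"
      using rd_continuous_norm_bound[OF rd] by blast
    have "bounded (x ` (T \<inter> {a..b}))"
      by (rule bounded_image_Icc) (rule integral_solution_bounded[OF x])
    then obtain K where K: "\<And>t. t \<in> T \<inter> {a..b} \<Longrightarrow> norm (x t) \<le> K" unfolding bounded_iff by blast
    have "norm (?g t) \<le> M * K" if t: "t \<in> T \<inter> {a..b}" for t
    proof -
      have "norm (?g t) \<le> norm (L t) * norm (x t)" by (rule norm_blinfun)
      also have "\<dots> \<le> M * K" using M t K by (intro mult_mono) auto
      finally show ?thesis .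
    qed
    then show ?thesis unfolding bounded_iff by blast
  qed
  have cont: "continuous (at t within T) x" if t: "t \<in> T" for t
  proof -
    obtain C where C: "\<And>v. v \<in> T \<inter> {t-1..t+1} \<Longrightarrow> norm (?g v) \<le> C"
      using bdd[of "t-1" "t+1"] unfolding bounded_iff by blast
    \<comment> \<open>Continuity of \<open>x\<close> is not given here; it comes from the Lipschitz
      bound that the integral equation provides near \<open>t\<close>.\<close>
    have step: "norm (x v - x u) \<le> C * (v - u)" if "u \<in> T" "v \<in> T" "t-1 \<le> u" "u \<le> v" "v \<le> t+1" for u v
      using that by (intro has_integral_lipschitz[where g = ?g, OF that(1,2,4) int[OF that(1,2,4)]] C) auto
    have "C-lipschitz_on (T \<inter> {t-1..t+1}) x"
    proof (rule lipschitz_onI)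
      show "0 \<le> C" using C[of t] t by (auto intro: order_trans[OF norm_ge_zero])
      fix u v assume "u \<in> T \<inter> {t-1..t+1}" "v \<in> T \<inter> {t-1..t+1}"
      then show "dist (x u) (x v) \<le> C * dist u v"
        using step[of u v] step[of v u] by (cases "u \<le> v") (auto simp: dist_norm norm_minus_commute)
    qed
    from lipschitz_on_continuous_on[OF this]
    have "continuous (at t within (T \<inter> {t-1..t+1})) x"
      using t by (auto simp: continuous_on_eq_continuous_within)
    moreover have "at t within (T \<inter> {t-1..t+1}) = at t within T"
      by (rule at_within_nhd[of t "{t-1<..<t+1}"]) auto
    ultimately show ?thesis by simp
  qed
  have g: "continuous (at t within T) ?g" if "right_dense T t" for t
    using rd that cont[of t] by (auto intro!: continuous_intros simp: rd_continuous_def right_dense_def)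
  show ?thesis
    unfolding delta_solution_def using has_integral_imp_delta_derivative[OF g bdd int] by blast
qed

theorem delta_solution_unique:
  fixes L :: "real \<Rightarrow> 'e::euclidean_space \<Rightarrow>\<^sub>L 'e"
  assumes rd: "rd_continuous T L"
    and reg: "\<forall>t\<in>T. \<forall>v. v + mu T t *\<^sub>R L t v = 0 \<longrightarrow> v = 0"
    and x: "delta_solution L x" and y: "delta_solution L y"
    and w: "w \<in> T" "x w = y w" and t: "t \<in> T"
  shows "x t = y t"
proof -
  have tw: "min t w \<in> T" "max t w \<in> T" using t w by (auto simp: min_def max_def)
  have z: "integral_solution L (min t w) (max t w) (\<lambda>t. x t - y t)"
    by (intro integral_solution_diff delta_solution_imp_integral_solution rd x y)
  have "x w - y w = 0" using w by simp
  from integral_solution_zero[OF z rd reg tw w(1) _ _ this t]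
  have "x t - y t = 0" by simp
  then show ?thesis by simp
qed

theorem exists_delta_solution:
  fixes L :: "real \<Rightarrow> 'e::euclidean_space \<Rightarrow>\<^sub>L 'e"
  assumes rd: "rd_continuous T L"
    and reg: "\<forall>t\<in>T. \<forall>v. v + mu T t *\<^sub>R L t v = 0 \<longrightarrow> v = 0"
    and w: "w \<in> T"
  obtains x where "delta_solution L x" "x w = v"
proof -
  obtain x where x: "\<forall>a\<in>T. \<forall>b\<in>T. integral_solution L a b x" "x w = v"
    using exists_global_integral_solution[OF rd reg w] by blast
  then have "delta_solution L x" by (intro integral_solution_imp_delta_solution[OF rd]) simp
  then show thesis using x(2) by (rule that)
qed

end

section \<open>Matrices and periodicity\<close>

lemma has_delta_derivative_bounded_linear:
  assumes F: "bounded_linear F" and f: "has_delta_derivative T f D t"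
  shows "has_delta_derivative T (\<lambda>t. F (f t)) (F D) t"
  unfolding has_delta_derivative_def
proof (intro allI impI)
  interpret F: bounded_linear F by (rule F)
  obtain K where K: "K > 0" "\<And>v. norm (F v) \<le> norm v * K" using F.pos_bounded by blast
  fix \<epsilon> :: real assume "\<epsilon> > 0"
  then obtain \<delta> where \<delta>: "\<delta> > 0" "\<And>s. \<lbrakk>s \<in> T; \<bar>t - s\<bar> < \<delta>\<rbrakk> \<Longrightarrow>
      norm (f (sigma T t) - f s - (sigma T t - s) *\<^sub>R D) \<le> \<epsilon> / K * \<bar>sigma T t - s\<bar>"
    using f K unfolding has_delta_derivative_def by (metis divide_pos_pos)
  show "\<exists>\<delta>>0. \<forall>s\<in>T. \<bar>t - s\<bar> < \<delta> \<longrightarrow>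
      norm (F (f (sigma T t)) - F (f s) - (sigma T t - s) *\<^sub>R F D) \<le> \<epsilon> * \<bar>sigma T t - s\<bar>"
  proof (intro exI[of _ \<delta>] conjI \<delta>(1) ballI impI)
    fix s assume s: "s \<in> T" "\<bar>t - s\<bar> < \<delta>"
    have "norm (F (f (sigma T t)) - F (f s) - (sigma T t - s) *\<^sub>R F D)
        = norm (F (f (sigma T t) - f s - (sigma T t - s) *\<^sub>R D))"
      by (simp add: F.diff F.scaleR)
    also have "\<dots> \<le> norm (f (sigma T t) - f s - (sigma T t - s) *\<^sub>R D) * K" by (rule K)
    also have "\<dots> \<le> \<epsilon> / K * \<bar>sigma T t - s\<bar> * K" using \<delta>(2)[OF s] K by (intro mult_right_mono) auto
    finally show "norm (F (f (sigma T t)) - F (f s) - (sigma T t - s) *\<^sub>R F D) \<le> \<epsilon> * \<bar>sigma T t - s\<bar>"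
      using K by simp
  qed
qed

text \<open>Equal graininess means \<open>sigma T (t + p) = sigma T t + p\<close>, and the points
  \<open>s + p\<close> with \<open>s\<close> in \<open>T\<close> are among those tested at
  \<open>t + p\<close>.\<close>

lemma has_delta_derivative_shift:
  assumes T: "\<And>t. t \<in> T \<Longrightarrow> t + p \<in> T" "mu T (t + p) = mu T t"
    and f: "has_delta_derivative T f D (t + p)"
  shows "has_delta_derivative T (\<lambda>t. f (t + p)) D t"
  unfolding has_delta_derivative_def
proof (intro allI impI)
  have sig: "sigma T (t + p) = sigma T t + p" using T(2) by (simp add: mu_def)
  fix \<epsilon> :: real assume "\<epsilon> > 0"
  then obtain \<delta> where \<delta>: "\<delta> > 0" "\<And>s. \<lbrakk>s \<in> T; \<bar>t + p - s\<bar> < \<delta>\<rbrakk> \<Longrightarrow>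
      norm (f (sigma T t + p) - f s - (sigma T t + p - s) *\<^sub>R D) \<le> \<epsilon> * \<bar>sigma T t + p - s\<bar>"
    using f unfolding has_delta_derivative_def sig by blast
  show "\<exists>\<delta>>0. \<forall>s\<in>T. \<bar>t - s\<bar> < \<delta> \<longrightarrow>
      norm (f (sigma T t + p) - f (s + p) - (sigma T t - s) *\<^sub>R D) \<le> \<epsilon> * \<bar>sigma T t - s\<bar>"
    using \<delta>(1) \<delta>(2)[OF T(1)] by (intro exI[of _ \<delta>]) (auto simp: algebra_simps)
qed

text \<open>The jump of a point of \<open>T\<close> is again in \<open>T\<close>, so the definition
  sees the function only on \<open>T\<close>. This allows a solution to be made extensional.\<close>

lemma (in unbounded_time_scale) has_delta_derivative_cong:
  assumes "\<And>s. s \<in> T \<Longrightarrow> f s = g s" "t \<in> T"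
  shows "has_delta_derivative T f D t \<longleftrightarrow> has_delta_derivative T g D t"
  using assms(1) assms(1)[OF sigma_in[OF assms(2)]] by (simp add: has_delta_derivative_def cong: ball_cong)

lemma rd_continuous_bounded_linear:
  assumes F: "bounded_linear F" and f: "rd_continuous T f"
  shows "rd_continuous T (\<lambda>t. F (f t))"
  unfolding rd_continuous_def
proof (intro conjI allI impI)
  show "continuous (at t within T) (\<lambda>t. F (f t))" if "right_dense T t" for t
    using f that by (intro bounded_linear.continuous[OF F]) (simp add: rd_continuous_def)
  fix t assume "left_dense T t"
  then obtain l where "(f \<longlongrightarrow> l) (at t within (T \<inter> {..<t}))"
    using f unfolding rd_continuous_def by blast
  then show "\<exists>l. ((\<lambda>t. F (f t)) \<longlongrightarrow> l) (at t within (T \<inter> {..<t}))"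
    using bounded_linear.tendsto[OF F] by blast
qed

lemma bounded_bilinear_matrix_vector_mult:
  "bounded_bilinear ((*v) :: real ^ 'n ^ 'm \<Rightarrow> real ^ 'n \<Rightarrow> real ^ 'm)"
  unfolding bilinear_conv_bounded_bilinear[symmetric] bilinear_def linear_iff
  by (simp add: vec_eq_iff matrix_vector_mult_def sum.distrib sum_distrib_left algebra_simps)

lemma bounded_bilinear_matrix_matrix_mult:
  "bounded_bilinear ((**) :: real ^ 'n ^ 'm \<Rightarrow> real ^ 'k ^ 'n \<Rightarrow> real ^ 'k ^ 'm)"
  unfolding bilinear_conv_bounded_bilinear[symmetric] bilinear_def linear_iff
  by (simp add: vec_eq_iff matrix_matrix_mult_def sum.distrib sum_distrib_left algebra_simps)

text \<open>Going through \<open>bounded_bilinear.prod_right\<close> makes the dependence on the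
  matrix itself bounded linear, which carries rd-continuity of the matrix function over to the
  operators.\<close>

definition matrix_blinfun :: "real ^ 'n ^ 'm \<Rightarrow> (real ^ 'n) \<Rightarrow>\<^sub>L (real ^ 'm)" where
  "matrix_blinfun = bounded_bilinear.prod_right (*v)"

definition matrix_mult_blinfun :: "real ^ 'n ^ 'm \<Rightarrow> (real ^ 'k ^ 'n) \<Rightarrow>\<^sub>L (real ^ 'k ^ 'm)" where
  "matrix_mult_blinfun = bounded_bilinear.prod_right (**)"

lemma matrix_blinfun_apply [simp]: "matrix_blinfun M v = M *v v"
  by (simp add: matrix_blinfun_def bounded_bilinear.prod_right.rep_eq[OF bounded_bilinear_matrix_vector_mult])

lemma matrix_mult_blinfun_apply [simp]: "matrix_mult_blinfun M N = M ** N"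
  by (simp add: matrix_mult_blinfun_def bounded_bilinear.prod_right.rep_eq[OF bounded_bilinear_matrix_matrix_mult])

lemma bounded_linear_matrix_blinfun: "bounded_linear matrix_blinfun"
  unfolding matrix_blinfun_def
  by (rule bounded_bilinear.bounded_linear_prod_right[OF bounded_bilinear_matrix_vector_mult])

lemma bounded_linear_matrix_mult_blinfun: "bounded_linear matrix_mult_blinfun"
  unfolding matrix_mult_blinfun_def
  by (rule bounded_bilinear.bounded_linear_prod_right[OF bounded_bilinear_matrix_matrix_mult])

section \<open>Solutions and transition matrix of a regressive system\<close>

locale regressive_system = unbounded_time_scale +
  fixes A :: "real \<Rightarrow> real ^ 'n ^ 'n"
  assumes regressive: "regressive T A"
begin

lemma rd_continuous_matrix_blinfun: "rd_continuous T (\<lambda>t. matrix_blinfun (A t))"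
  and rd_continuous_matrix_mult_blinfun: "rd_continuous T (\<lambda>t. matrix_mult_blinfun (A t))"
proof -
  have rd: "rd_continuous T A" using regressive by (simp add: regressive_def)
  show "rd_continuous T (\<lambda>t. matrix_blinfun (A t))"
    by (rule rd_continuous_bounded_linear[OF bounded_linear_matrix_blinfun rd])
  show "rd_continuous T (\<lambda>t. matrix_mult_blinfun (A t))"
    by (rule rd_continuous_bounded_linear[OF bounded_linear_matrix_mult_blinfun rd])
qed

text \<open>Multiplication by a left inverse of \<open>mat 1 + mu T t *\<^sub>R A t\<close> gives
  the injectivity that the abstract theory asks for.\<close>

lemma regressive_matrix_mult_blinfun:
  "\<forall>t\<in>T. \<forall>V :: real ^ 'k ^ 'n. V + mu T t *\<^sub>R matrix_mult_blinfun (A t) V = 0 \<longrightarrow> V = 0"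
proof (intro ballI allI impI)
  fix t and V :: "real ^ 'k ^ 'n" assume t: "t \<in> T" and V: "V + mu T t *\<^sub>R matrix_mult_blinfun (A t) V = 0"
  obtain B where B: "B ** (mat 1 + mu T t *\<^sub>R A t) = mat 1"
    using regressive t by (auto simp: regressive_def invertible_def)
  have "(mat 1 + mu T t *\<^sub>R A t) ** V = 0"
    using V by (simp add: bounded_bilinear.add_left[OF bounded_bilinear_matrix_matrix_mult]
      bounded_bilinear.scaleR_left[OF bounded_bilinear_matrix_matrix_mult])
  then have "(B ** (mat 1 + mu T t *\<^sub>R A t)) ** V = 0"
    by (simp flip: matrix_mul_assoc)
  then show "V = 0" by (simp add: B)
qed

lemma regressive_matrix_blinfun: "\<forall>t\<in>T. \<forall>v. v + mu T t *\<^sub>R matrix_blinfun (A t) v = 0 \<longrightarrow> v = 0"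
proof (intro ballI allI impI)
  fix t v assume t: "t \<in> T" and v: "v + mu T t *\<^sub>R matrix_blinfun (A t) v = 0"
  obtain B where B: "B ** (mat 1 + mu T t *\<^sub>R A t) = mat 1"
    using regressive t by (auto simp: regressive_def invertible_def)
  have "(mat 1 + mu T t *\<^sub>R A t) *v v = 0"
    using v by (simp add: bounded_bilinear.add_left[OF bounded_bilinear_matrix_vector_mult]
      bounded_bilinear.scaleR_left[OF bounded_bilinear_matrix_vector_mult])
  then have "(B ** (mat 1 + mu T t *\<^sub>R A t)) *v v = 0"
    by (simp flip: matrix_vector_mul_assoc)
  then show "v = 0" by (simp add: B)
qed

lemma solves_ivp_iff:
  "solves_ivp T A w v x \<longleftrightarrow> delta_solution (\<lambda>t. matrix_blinfun (A t)) x \<and> x w = v"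
  by (simp add: solves_ivp_def delta_solution_def)

lemma solves_matrix_ivp_iff:
  "solves_matrix_ivp T A w X \<longleftrightarrow> delta_solution (\<lambda>t. matrix_mult_blinfun (A t)) X \<and> X w = mat 1"
  by (simp add: solves_matrix_ivp_def delta_solution_def)

lemma solves_ivp_unique:
  assumes "solves_ivp T A w v x" "solves_ivp T A w v y" "w \<in> T" "t \<in> T"
  shows "x t = y t"
proof -
  have "delta_solution (\<lambda>t. matrix_blinfun (A t)) x" "delta_solution (\<lambda>t. matrix_blinfun (A t)) y" "x w = y w"
    using assms(1,2) by (simp_all add: solves_ivp_iff)
  from delta_solution_unique[OF rd_continuous_matrix_blinfun regressive_matrix_blinfun this(1,2) assms(3) this(3) assms(4)] show ?thesis .
qed

text \<open>This justifies the definite description: a solution exists and still solves after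
  restriction to \<open>T\<close>, while uniqueness on \<open>T\<close> together with extensionality
  determines it as a function.\<close>

lemma solves_matrix_ivp_transition_matrix:
  assumes w: "w \<in> T"
  shows "solves_matrix_ivp T A w (\<lambda>t. transition_matrix T A t w)"
proof -
  obtain X where X: "solves_matrix_ivp T A w X"
    using exists_delta_solution[OF rd_continuous_matrix_mult_blinfun regressive_matrix_mult_blinfun w, of "mat 1"] unfolding solves_matrix_ivp_iff by blast
  define Y where "Y = restrict X T"
  have Y: "solves_matrix_ivp T A w Y"
    using X w has_delta_derivative_cong[of X Y] by (simp add: solves_matrix_ivp_def Y_def)
  have ext: "Y \<in> extensional T" by (simp add: Y_def)
  have "(THE X. X \<in> extensional T \<and> solves_matrix_ivp T A w X) = Y"
  proof (rule the_equality)
    show "Y \<in> extensional T \<and> solves_matrix_ivp T A w Y" using ext Y by simp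
    fix Z assume Z: "Z \<in> extensional T \<and> solves_matrix_ivp T A w Z"
    show "Z = Y"
    proof (rule extensionalityI[OF conjunct1[OF Z] ext])
      have "delta_solution (\<lambda>t. matrix_mult_blinfun (A t)) Z" "delta_solution (\<lambda>t. matrix_mult_blinfun (A t)) Y" "Z w = Y w"
        using Y Z by (simp_all add: solves_matrix_ivp_iff)
      note * = delta_solution_unique[OF rd_continuous_matrix_mult_blinfun regressive_matrix_mult_blinfun this(1,2) w this(3)]
      fix t assume "t \<in> T"
      then show "Z t = Y t" by (rule *)
    qed
  qed
  then have "(\<lambda>t. transition_matrix T A t w) = Y"
    by (simp only: transition_matrix_def)
  then show ?thesis using Y by simp
qed

lemma solves_ivp_transition_matrix:
  assumes "w \<in> T"
  shows "solves_ivp T A w v (\<lambda>t. transition_matrix T A t w *v v)"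
  unfolding solves_ivp_def
proof (intro conjI ballI)
  let ?\<Phi> = "\<lambda>t. transition_matrix T A t w"
  have \<Phi>: "solves_matrix_ivp T A w ?\<Phi>" by (rule solves_matrix_ivp_transition_matrix[OF assms])
  then show "?\<Phi> w *v v = v" by (simp add: solves_matrix_ivp_def)
  fix t assume "t \<in> T"
  then have "has_delta_derivative T ?\<Phi> (A t ** ?\<Phi> t) t" using \<Phi> by (simp add: solves_matrix_ivp_def)
  from has_delta_derivative_bounded_linear[OF
      bounded_bilinear.bounded_linear_left[OF bounded_bilinear_matrix_vector_mult] this, of v]
  show "has_delta_derivative T (\<lambda>t. ?\<Phi> t *v v) (A t *v (?\<Phi> t *v v)) t"
    by (simp only: matrix_vector_mul_assoc)
qed

end

section \<open>Periodic solutions and fixed vectors of the transition matrix over one period\<close>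

theorem theorem3p11:
  fixes p t\<^sub>0 :: real and T :: "real set" and A :: "real \<Rightarrow> real ^ 'n ^ 'n"
  assumes "p > 0"
    and "periodic_time_scale p T"
    and "regressive T A"
    and "periodic_on T p A"
    and "t\<^sub>0 \<in> T"
  shows "(\<exists>x\<^sub>0. x\<^sub>0 \<noteq> 0 \<and> (\<exists>x. solves_ivp T A t\<^sub>0 x\<^sub>0 x \<and> periodic_on T p x)) \<longleftrightarrow>
         eigenvalue (transition_matrix T A (t\<^sub>0 + p) t\<^sub>0) 1"
proof -
  have shift: "t + p \<in> T" "mu T (t + p) = mu T t" if "t \<in> T" for t
    using assms(2) that by (auto simp: periodic_time_scale_def)
  interpret regressive_system T A
  proof
    show "closed T" using assms(2) by (simp add: periodic_time_scale_def time_scale_def)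
    show "\<exists>s\<in>T. t < s" if "t \<in> T" for t
      using shift(1)[OF that] \<open>p > 0\<close> by (intro bexI[of _ "t + p"]) auto
  qed fact
  let ?\<Phi> = "\<lambda>t. transition_matrix T A t t\<^sub>0"
  show ?thesis
  proof
    assume "\<exists>x\<^sub>0. x\<^sub>0 \<noteq> 0 \<and> (\<exists>x. solves_ivp T A t\<^sub>0 x\<^sub>0 x \<and> periodic_on T p x)"
    then obtain x\<^sub>0 x where x: "x\<^sub>0 \<noteq> 0" "solves_ivp T A t\<^sub>0 x\<^sub>0 x" "periodic_on T p x" by blast
    have "?\<Phi> (t\<^sub>0 + p) *v x\<^sub>0 = x (t\<^sub>0 + p)"
      using solves_ivp_unique[OF solves_ivp_transition_matrix x(2)] shift assms(5) by blast
    also have "\<dots> = x\<^sub>0" using x assms(5) by (simp add: periodic_on_def solves_ivp_def)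
    finally show "eigenvalue (?\<Phi> (t\<^sub>0 + p)) 1" using x(1) by (auto simp: eigenvalue_def)
  next
    assume "eigenvalue (?\<Phi> (t\<^sub>0 + p)) 1"
    then obtain v where v: "v \<noteq> 0" "?\<Phi> (t\<^sub>0 + p) *v v = v" by (auto simp: eigenvalue_def)
    define x where "x = (\<lambda>t. ?\<Phi> t *v v)"
    have x: "solves_ivp T A t\<^sub>0 v x"
      unfolding x_def by (rule solves_ivp_transition_matrix[OF assms(5)])
    \<comment> \<open>The translate satisfies the same equation by periodicity of \<open>A\<close>,
      and its state at \<open>t\<^sub>0\<close> is \<open>?\<Phi> (t\<^sub>0 + p) *v v\<close>, that
      is, \<open>v\<close> again.\<close>
    have "solves_ivp T A t\<^sub>0 v (\<lambda>t. x (t + p))"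
      unfolding solves_ivp_def
    proof (intro conjI ballI)
      fix t assume t: "t \<in> T"
      have "A (t + p) = A t" using assms(4) t by (simp add: periodic_on_def)
      then have "has_delta_derivative T x (A t *v x (t + p)) (t + p)"
        using x shift(1)[OF t] by (metis solves_ivp_def)
      then show "has_delta_derivative T (\<lambda>t. x (t + p)) (A t *v x (t + p)) t"
        using shift t by (intro has_delta_derivative_shift)
    qed (simp add: x_def v)
    from solves_ivp_unique[OF this x assms(5)] have "periodic_on T p x"
      by (simp add: periodic_on_def)
    then show "\<exists>x\<^sub>0. x\<^sub>0 \<noteq> 0 \<and> (\<exists>x. solves_ivp T A t\<^sub>0 x\<^sub>0 x \<and> periodic_on T p x)"
      using v(1) x by blast
  qed
qed

end
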